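(* Let $(M_N)$ be probability measures on $\mathbb Y(N)$ whose Jack generating functions $F_N(\mathbf p;\theta)$ satisfy Assumption A, and let $F_N(x_1,\dots,x_N;\theta)=\sum_{\lambda\in\mathbb Y(N)}M_N(\lambda)J_\lambda(x_1,\dots,x_N;\theta)/J_\lambda(1^N;\theta)$ be the $N$-variable version. Write $\Psi_N=\ln F_N(x_1,\dots,x_N;\theta)$ and evaluate derivatives at $x_1=\dots=x_N=1$. Then: (a) Assumption L holds (with constants $\mathfrak c_k$) if and only if: for every index $i$ and $k\ge1$, $\lim_N\frac1N\partial_i^k\Psi_N|_{1^N}=\mathfrak c_k$; and for every $r\ge2$ and indices $i_1,\dots,i_r$ with at least two distinct, $\lim_N\frac1N\partial_{i_1}\cdots\partial_{i_r}\Psi_N|_{1^N}=0$. (b) Assumption C holds (with constants $\mathfrak c_k,\mathfrak d_{k,l}$) if and only if: for every $i$ and $k\ge1$, $\lim_N\frac1N\partial_i^k\Psi_N|_{1^N}=\mathfrak c_k$; for distinct $i,j$ and $k,l\ge1$, $\lim_N\partial_i^k\partial_j^l\Psi_N|_{1^N}=\mathfrak d_{k,l}$; and for $r\ge3$ and indices $i_1,\dots,i_r$ with at least three distinct, $\lim_N\partial_{i_1}\cdots\partial_{i_r}\Psi_N|_{1^N}=0$.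
   Context: Fix $\theta>0$. Young diagrams, $\ell(\lambda)$, $|\lambda|$, $\mathbb Y(N)$ (at most $N$ nonzero parts), $\mathbb Y$. Symmetric functions $=\mathbb R[p_1,p_2,\dots]$, $p_n=\sum_ix_i^n$, $p_\lambda=\prod p_{\lambda_i}$. $J_\lambda(\mathbf p;\theta)$ = Jack symmetric function (orthogonal for $\langle p_\lambda,p_\mu\rangle=\delta_{\lambda\mu}z_\lambda\theta^{-\ell(\lambda)}$, triangular in the monomial basis, leading term $x_1^{\lambda_1}\cdots x_\ell^{\lambda_\ell}$); $J_\lambda(x_1,\dots,x_N;\theta)$ its specialization $x_{N+1}=\dots=0$. "$\mathbf p=1^N$": $p_n=N$ for all $n$. $F_N(\mathbf p;\theta)=\sum_{\lambda\in\mathbb Y(N)}M_N(\lambda)J_\lambda(\mathbf p;\theta)/J_\lambda(1^N;\theta)=\sum_{\lambda\in\mathbb Y}a_{M_N}(\lambda)p_\lambda$. Assumption A: there is $\varepsilon>0$ with $\sum_\lambda|a_{M_N}(\lambda)|N^{\ell(\lambda)}|x|^{|\lambda|}<\infty$ for all $N$, $|x|<1+\varepsilon$. Assumption L: (1) $\lim_N\frac1N\sum_{i\ge1}k!\binom ik\partial_{p_i}\ln F_N|_{1^N}=\mathfrak c_k$ for each $k\ge1$; (2) for $r\ge2$, $k_1,\dots,k_r\ge1$: $\lim_N\frac1N\sum_{i_1,\dots,i_r\ge1}\prod_j\binom{i_j}{k_j}\partial_{p_{i_1}}\cdots\partial_{p_{i_r}}\ln F_N|_{1^N}=0$. Assumption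 C: (1) as L(1); (2) $\lim_N\sum_{i,j\ge1}k!l!\binom ik\binom jl\partial_{p_i}\partial_{p_j}\ln F_N|_{1^N}=\mathfrak d_{k,l}$ for $k,l\ge1$; (3) for $r\ge3$: $\lim_N\sum_{i_1,\dots,i_r\ge1}\prod_j\binom{i_j}{k_j}\partial_{p_{i_1}}\cdots\partial_{p_{i_r}}\ln F_N|_{1^N}=0$. *)

theory Defs
  imports "HOL-Analysis.Analysis" "HOL-Probability.Probability"
begin

definition partitions :: "nat list set" where
  "partitions = {l. sorted_wrt (\<ge>) l \<and> 0 \<notin> set l}"

definition Yd :: "nat \<Rightarrow> nat list set" where
  "Yd N = {l \<in> partitions. length l \<le> N}"

definition ptn :: "nat \<Rightarrow> nat list set" where
  "ptn n = {l \<in> partitions. sum_list l = n}"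

text \<open>A point p of the "p-space": p n is the value of the power sum p_n.
  p_lambda = product of p_(lambda_i).\<close>
definition pmono :: "(nat \<Rightarrow> real) \<Rightarrow> nat list \<Rightarrow> real" where
  "pmono p l = prod_list (map p l)"

definition zee :: "nat list \<Rightarrow> real" where
  "zee l = (\<Prod>i\<in>set l. real i ^ count_list l i * fact (count_list l i))"

text \<open>Homogeneous symmetric functions of degree n are coefficient functions on ptn n
  (coefficients w.r.t. p_mu). Jack inner product: <p_l,p_m> = delta z_l theta^(-l(l)).\<close>
definition jinner :: "real \<Rightarrow> nat \<Rightarrow> (nat list \<Rightarrow> real) \<Rightarrow> (nat list \<Rightarrow> real) \<Rightarrow> real" where
  "jinner \<theta> n f g = (\<Sum>m\<in>ptn n. f m * g m * zee m / \<theta> ^ length m)"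

text \<open>Coefficient of the monomial x_1^(v_1)...x_k^(v_k) in p_m: number of ways to
  distribute the parts of m among the variables 1..k with prescribed exponents.\<close>
definition monocoef :: "nat list \<Rightarrow> nat list \<Rightarrow> nat" where
  "monocoef m v = card {f \<in> {..<length m} \<rightarrow>\<^sub>E {..<length v}.
      \<forall>i<length v. (\<Sum>j | j < length m \<and> f j = i. m ! j) = v ! i}"

text \<open>Coefficient of the monomial symmetric function m_v in the symmetric function
  with p-coefficients c.\<close>
definition mcoef :: "(nat list \<Rightarrow> real) \<Rightarrow> nat list \<Rightarrow> real" where
  "mcoef c v = (\<Sum>m\<in>ptn (sum_list v). c m * real (monocoef m v))"

definition dominates :: "nat list \<Rightarrow> nat list \<Rightarrow> bool" where
  "dominates l v \<longleftrightarrow> sum_list l = sum_list v \<and>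
     (\<forall>k. sum_list (take k v) \<le> sum_list (take k l))"

text \<open>Jack symmetric functions: orthogonal, triangular in the monomial basis
  (w.r.t. dominance) with leading term x_1^(l_1)...x_k^(l_k) (coefficient 1).
  J l m = coefficient of p_m in J_l.\<close>
definition is_jack_family :: "real \<Rightarrow> (nat list \<Rightarrow> nat list \<Rightarrow> real) \<Rightarrow> bool" where
  "is_jack_family \<theta> J \<longleftrightarrow>
     (\<forall>l. l \<notin> partitions \<longrightarrow> J l = (\<lambda>_. 0)) \<and>
     (\<forall>l\<in>partitions.
        (\<forall>m. m \<notin> ptn (sum_list l) \<longrightarrow> J l m = 0) \<and>
        mcoef (J l) l = 1 \<and>
        (\<forall>v\<in>ptn (sum_list l). mcoef (J l) v \<noteq> 0 \<longrightarrow> dominates l v)) \<and>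
     (\<forall>l\<in>partitions. \<forall>k\<in>partitions. sum_list l = sum_list k \<and> l \<noteq> k \<longrightarrow>
        jinner \<theta> (sum_list l) (J l) (J k) = 0)"

definition jack :: "real \<Rightarrow> nat list \<Rightarrow> nat list \<Rightarrow> real" where
  "jack \<theta> = (THE J. is_jack_family \<theta> J)"

definition jack_eval :: "real \<Rightarrow> nat list \<Rightarrow> (nat \<Rightarrow> real) \<Rightarrow> real" where
  "jack_eval \<theta> l p = (\<Sum>m\<in>ptn (sum_list l). jack \<theta> l m * pmono p m)"

text \<open>a_{M_N}(m): p-coefficients of F_N = sum_l M_N(l) J_l / J_l(1^N).\<close>
definition acoef :: "real \<Rightarrow> (nat \<Rightarrow> nat list pmf) \<Rightarrow> nat \<Rightarrow> nat list \<Rightarrow> real" where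
  "acoef \<theta> M N m = (\<Sum>l\<in>Yd N \<inter> ptn (sum_list m).
      pmf (M N) l * jack \<theta> l m / jack_eval \<theta> l (\<lambda>_. real N))"

definition FN :: "real \<Rightarrow> (nat \<Rightarrow> nat list pmf) \<Rightarrow> nat \<Rightarrow> (nat \<Rightarrow> real) \<Rightarrow> real" where
  "FN \<theta> M N p = (\<Sum>\<^sub>\<infinity>m\<in>partitions. acoef \<theta> M N m * pmono p m)"

definition FNx :: "real \<Rightarrow> (nat \<Rightarrow> nat list pmf) \<Rightarrow> nat \<Rightarrow> (nat \<Rightarrow> real) \<Rightarrow> real" where
  "FNx \<theta> M N x = FN \<theta> M N (\<lambda>n. \<Sum>i<N. x i ^ n)"

definition lnF :: "real \<Rightarrow> (nat \<Rightarrow> nat list pmf) \<Rightarrow> nat \<Rightarrow> (nat \<Rightarrow> real) \<Rightarrow> real" where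
  "lnF \<theta> M N p = ln (FN \<theta> M N p)"

definition Psi :: "real \<Rightarrow> (nat \<Rightarrow> nat list pmf) \<Rightarrow> nat \<Rightarrow> (nat \<Rightarrow> real) \<Rightarrow> real" where
  "Psi \<theta> M N x = ln (FNx \<theta> M N x)"

fun pdiff :: "nat list \<Rightarrow> ((nat \<Rightarrow> real) \<Rightarrow> real) \<Rightarrow> (nat \<Rightarrow> real) \<Rightarrow> real" where
  "pdiff [] G = G"
| "pdiff (i # is) G = (\<lambda>p. deriv (\<lambda>t. pdiff is G (p(i := t))) (p i))"

definition assumpA :: "real \<Rightarrow> (nat \<Rightarrow> nat list pmf) \<Rightarrow> bool" where
  "assumpA \<theta> M \<longleftrightarrow> (\<exists>\<epsilon>>0. \<forall>N. \<forall>x::real. \<bar>x\<bar> < 1 + \<epsilon> \<longrightarrow>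
      (\<lambda>m. \<bar>acoef \<theta> M N m\<bar> * real N ^ length m * \<bar>x\<bar> ^ sum_list m) summable_on partitions)"

definition tuples :: "nat \<Rightarrow> nat list set" where
  "tuples r = {is. length is = r \<and> (\<forall>i\<in>set is. 1 \<le> i)}"

definition Dsum :: "real \<Rightarrow> (nat \<Rightarrow> nat list pmf) \<Rightarrow> nat \<Rightarrow> nat list \<Rightarrow> real" where
  "Dsum \<theta> M N ks = (\<Sum>\<^sub>\<infinity>is\<in>tuples (length ks).
      (\<Prod>j<length ks. real (is ! j choose ks ! j)) * pdiff is (lnF \<theta> M N) (\<lambda>_. real N))"

definition assumpL :: "real \<Rightarrow> (nat \<Rightarrow> nat list pmf) \<Rightarrow> (nat \<Rightarrow> real) \<Rightarrow> bool" where
  "assumpL \<theta> M c \<longleftrightarrow>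
    (\<forall>k\<ge>1. (\<lambda>N. fact k * Dsum \<theta> M N [k] / real N) \<longlonglongrightarrow> c k) \<and>
    (\<forall>ks. 2 \<le> length ks \<and> (\<forall>k\<in>set ks. 1 \<le> k) \<longrightarrow>
        (\<lambda>N. Dsum \<theta> M N ks / real N) \<longlonglongrightarrow> 0)"

definition assumpC :: "real \<Rightarrow> (nat \<Rightarrow> nat list pmf) \<Rightarrow> (nat \<Rightarrow> real) \<Rightarrow> (nat \<Rightarrow> nat \<Rightarrow> real) \<Rightarrow> bool" where
  "assumpC \<theta> M c d \<longleftrightarrow>
    (\<forall>k\<ge>1. (\<lambda>N. fact k * Dsum \<theta> M N [k] / real N) \<longlonglongrightarrow> c k) \<and>
    (\<forall>k\<ge>1. \<forall>l\<ge>1. (\<lambda>N. fact k * fact l * Dsum \<theta> M N [k, l]) \<longlonglongrightarrow> d k l) \<and>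
    (\<forall>ks. 3 \<le> length ks \<and> (\<forall>k\<in>set ks. 1 \<le> k) \<longrightarrow>
        (\<lambda>N. Dsum \<theta> M N ks) \<longlonglongrightarrow> 0)"

definition xcondL :: "real \<Rightarrow> (nat \<Rightarrow> nat list pmf) \<Rightarrow> (nat \<Rightarrow> real) \<Rightarrow> bool" where
  "xcondL \<theta> M c \<longleftrightarrow>
    (\<forall>i. \<forall>k\<ge>1. (\<lambda>N. pdiff (replicate k i) (Psi \<theta> M N) (\<lambda>_. 1) / real N) \<longlonglongrightarrow> c k) \<and>
    (\<forall>is. 2 \<le> length is \<and> 2 \<le> card (set is) \<longrightarrow>
        (\<lambda>N. pdiff is (Psi \<theta> M N) (\<lambda>_. 1) / real N) \<longlonglongrightarrow> 0)"

definition xcondC :: "real \<Rightarrow> (nat \<Rightarrow> nat list pmf) \<Rightarrow> (nat \<Rightarrow> real) \<Rightarrow> (nat \<Rightarrow> nat \<Rightarrow> real) \<Rightarrow> bool" where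
  "xcondC \<theta> M c d \<longleftrightarrow>
    (\<forall>i. \<forall>k\<ge>1. (\<lambda>N. pdiff (replicate k i) (Psi \<theta> M N) (\<lambda>_. 1) / real N) \<longlonglongrightarrow> c k) \<and>
    (\<forall>i j. \<forall>k\<ge>1. \<forall>l\<ge>1. i \<noteq> j \<longrightarrow>
        (\<lambda>N. pdiff (replicate k i @ replicate l j) (Psi \<theta> M N) (\<lambda>_. 1)) \<longlonglongrightarrow> d k l) \<and>
    (\<forall>is. 3 \<le> length is \<and> 3 \<le> card (set is) \<longrightarrow>
        (\<lambda>N. pdiff is (Psi \<theta> M N) (\<lambda>_. 1)) \<longlonglongrightarrow> 0)"

end

theory Submission
  imports Defs
begin

text \<open>Put \<open>p\<^sub>n = \<Sum>\<^sub>i (1 + u\<^sub>i)^n = N + \<Sum>\<^sub>k binom(n,k) y\<^sub>k\<close> with \<open>y\<^sub>k = \<Sum>\<^sub>i u\<^sub>i^k\<close>. The binomially weighted sums of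
  derivatives of \<open>ln F\<^sub>N\<close> at \<open>1\<^sup>N\<close> are then the Taylor coefficients of \<open>ln F\<^sub>N\<close> in the \<open>y\<^sub>k\<close>, and the derivatives
  of \<open>\<Psi>\<^sub>N\<close> at \<open>1\<^sup>N\<close> are those in the \<open>u\<^sub>i\<close>. By the chain rule each \<open>u\<close>-derivative is a finite
  combination, with coefficients not depending on \<open>N\<close>, of \<open>y\<close>-derivatives whose order is at least the
  number of distinct indices; this system is triangular, so the limits can be compared in both directions.
  The chain rule is only verified for monomials in the \<open>p\<^sub>n\<close>, where it is multiplicative, and carried
  over to \<open>F\<^sub>N\<close> by absolute convergence. It passes to \<open>ln F\<^sub>N\<close> because taking logarithms is an algebraic
  operation on Taylor coefficients, determined by \<open>F \<partial>(ln F) = \<partial>F\<close>.\<close>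

text \<open>The sums in \<open>Dsum\<close> run over infinitely many indices with polynomially
  growing weights. They converge because Assumption A reaches beyond radius 1: for some R > 1, the
  p-derivatives of F_N at 1^N up to any fixed order are bounded by a constant times R^(-(i_1 + ... +
  i_r)). Such decay survives products, reciprocals, logarithms and binomial summation. With index
  lists instead of exponents, the Leibniz product is the shuffle product on functions of words. It
  is commutative and associative for arbitrary functions, so symmetry of mixed derivatives is never
  invoked. The linear substitution in infinitely many variables (p to y) is kept apart from the
  nonlinear one with finite sums (y to u): convergence matters only in the first, combinatorics only
  in the second. Taking ln F_N needs F_N(1^N) > 0. Where this fails, all coefficients of F_N vanish
  as encoded, and both families of derivatives are zero.\<close>

subsection \<open>The algebra of jets\<close>

text \<open>A function \<open>b\<close> on index lists stores the iterated partial derivatives of a function at a point: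
  \<open>b [i, j, \<dots>]\<close> is the value of \<open>\<partial>\<^sub>i \<partial>\<^sub>j \<dots>\<close>. In these terms \<open>jdiff i\<close> is \<open>\<partial>\<^sub>i\<close> and \<open>jmult\<close> is the product
  of functions, by the Leibniz rule.\<close>

abbreviation jdiff :: "nat \<Rightarrow> (nat list \<Rightarrow> real) \<Rightarrow> nat list \<Rightarrow> real" where
  "jdiff i b \<equiv> (\<lambda>l. b (i # l))"

fun jmult :: "(nat list \<Rightarrow> real) \<Rightarrow> (nat list \<Rightarrow> real) \<Rightarrow> nat list \<Rightarrow> real" where
  "jmult b c [] = b [] * c []"
| "jmult b c (i # l) = jmult (jdiff i b) c l + jmult b (jdiff i c) l"

definition unit_jet :: "nat list \<Rightarrow> real" where
  "unit_jet l = (if l = [] then 1 else 0)"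

lemma unit_jet_simps [simp]: "unit_jet [] = 1" "unit_jet (i # l) = 0"
  by (simp_all add: unit_jet_def)

text \<open>As a \<open>fundef_cong\<close> rule this justifies the recursion of \<open>jinv\<close>
  through \<open>jmult\<close>, since calls inside a product are seen to reach only lists no longer
  than its argument. It also lets an induction hypothesis about shorter lists act inside a
  product.\<close>

lemma jmult_cong [fundef_cong]:
  assumes "l = l'"
    and "\<And>s. length s \<le> length l' \<Longrightarrow> b s = b' s"
    and "\<And>s. length s \<le> length l' \<Longrightarrow> c s = c' s"
  shows "jmult b c l = jmult b' c' l'"
  using assms(2,3) unfolding assms(1)
proof (induction l' arbitrary: b b' c c')
  case (Cons i l)
  have "jmult (jdiff i b) c l = jmult (jdiff i b') c' l" "jmult b (jdiff i c) l = jmult b' (jdiff i c') l"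
    by (rule Cons.IH; simp add: Cons.prems)+
  then show ?case by simp
qed simp

lemma jmult_add_left: "jmult (\<lambda>s. b s + b' s) c l = jmult b c l + jmult b' c l"
  by (induction l arbitrary: b b' c) (simp_all add: algebra_simps)

lemma jmult_comm: "jmult b c l = jmult c b l"
  by (induction l arbitrary: b c) simp_all

lemma jmult_add_right: "jmult b (\<lambda>s. c s + c' s) l = jmult b c l + jmult b c' l"
  by (metis jmult_comm jmult_add_left)

lemma jmult_zero_left [simp]: "jmult (\<lambda>_. 0) c l = 0"
  by (induction l arbitrary: c) simp_all

lemma jmult_zero_right [simp]: "jmult c (\<lambda>_. 0) l = 0"
  by (metis jmult_comm jmult_zero_left)

lemma jmult_scale_left: "jmult (\<lambda>s. r * b s) c l = r * jmult b c l"
  by (induction l arbitrary: b c) (simp_all add: algebra_simps)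

lemma jmult_scale_right: "jmult b (\<lambda>s. r * c s) l = r * jmult b c l"
  by (metis jmult_comm jmult_scale_left)

lemma jmult_minus_left: "jmult (\<lambda>s. - b s) c l = - jmult b c l"
  using jmult_scale_left[of "-1"] by simp

lemma jmult_minus_right: "jmult b (\<lambda>s. - c s) l = - jmult b c l"
  using jmult_scale_right[of _ "-1"] by simp

lemma jmult_sum_left:
  "finite K \<Longrightarrow> jmult (\<lambda>s. \<Sum>k\<in>K. u k s) c l = (\<Sum>k\<in>K. jmult (u k) c l)"
  by (induction K rule: finite_induct) (simp_all add: jmult_add_left)

lemma jmult_sum_right:
  "finite K \<Longrightarrow> jmult c (\<lambda>s. \<Sum>k\<in>K. u k s) l = (\<Sum>k\<in>K. jmult c (u k) l)"
  by (induction K rule: finite_induct) (simp_all add: jmult_add_right)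

lemma jmult_assoc: "jmult (jmult a b) c l = jmult a (jmult b c) l"
  by (induction l arbitrary: a b c) (simp_all add: jmult_add_left jmult_add_right algebra_simps)

lemma jmult_comm_fun: "jmult b c = jmult c b"
  using jmult_comm by blast

lemma jmult_assoc_fun: "jmult (jmult a b) c = jmult a (jmult b c)"
  using jmult_assoc by blast

lemma jmult_left_comm_fun: "jmult a (jmult b c) = jmult b (jmult a c)"
  by (metis jmult_assoc_fun jmult_comm_fun)

lemmas jmult_ac = jmult_assoc_fun jmult_comm_fun jmult_left_comm_fun

lemma jmult_unit_left [simp]: "jmult unit_jet b l = b l"
  by (induction l arbitrary: b) simp_all

lemma jmult_unit_right [simp]: "jmult b unit_jet l = b l"
  by (metis jmult_comm jmult_unit_left)

subsection \<open>Inverse and logarithm of jets\<close>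

text \<open>The rule \<partial>(1/f) = - \<partial>f / f^2. The eta-expanded calls expose the
  argument of \<open>jinv\<close> to the congruence rule, which termination needs.\<close>

function (sequential) jinv :: "(nat list \<Rightarrow> real) \<Rightarrow> nat list \<Rightarrow> real" where
  "jinv f [] = 1 / f []"
| "jinv f (i # l) = - jmult (jdiff i f) (\<lambda>s. jmult (\<lambda>t. jinv f t) (\<lambda>t. jinv f t) s) l"
  by pat_completeness auto
termination
  by (relation "inv_image less_than (\<lambda>(f, l). length l)") auto

fun jln :: "(nat list \<Rightarrow> real) \<Rightarrow> nat list \<Rightarrow> real" where
  "jln f [] = ln (f [])"
| "jln f (i # l) = jmult (jdiff i f) (jinv f) l"

lemma jmult_jinv:
  assumes "f [] \<noteq> 0"
  shows "jmult f (jinv f) l = unit_jet l"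
proof (induction l rule: length_induct)
  case (1 l)
  show ?case
  proof (cases l)
    case Nil
    then show ?thesis using assms by (simp add: unit_jet_def)
  next
    case (Cons i k)
    have "jmult f (jmult (jdiff i f) (jmult (jinv f) (jinv f))) k
        = jmult (jmult f (jinv f)) (jmult (jdiff i f) (jinv f)) k"
      by (simp only: jmult_ac)
    \<comment> \<open>\<open>k\<close> is shorter than \<open>l\<close>, so the induction hypothesis
      applies to the inner product at every list that occurs.\<close>
    also have "\<dots> = jmult unit_jet (jmult (jdiff i f) (jinv f)) k"
      using 1 Cons by (intro jmult_cong) auto
    finally show ?thesis using Cons
      by (simp add: jmult_minus_right unit_jet_def)
  qed
qed

text \<open>The equation can be divided by \<open>f\<close>, and the value at \<open>[]\<close>
  fixes the constant. To show that a substitution commutes with the logarithm, it then suffices to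
  check this equation for its image.\<close>

lemma jln_unique:
  assumes "f [] \<noteq> 0" "g [] = ln (f [])" "\<And>i l. jmult f (jdiff i g) l = f (i # l)"
  shows "g = jln f"
proof
  fix l
  show "g l = jln f l"
  proof (cases l)
    case (Cons i k)
    have "g l = jmult unit_jet (jdiff i g) k" using Cons by simp
    also have "unit_jet = jmult f (jinv f)" using jmult_jinv[of f] assms(1) by auto
    also have "jmult (jmult f (jinv f)) (jdiff i g) = jmult (jinv f) (jmult f (jdiff i g))" by (simp only: jmult_ac)
    also have "jmult f (jdiff i g) = jdiff i f" using assms(3) by auto
    finally show ?thesis using Cons by (simp add: jmult_comm_fun)
  qed (simp add: assms)
qed

lemma jdiff_jln: "jdiff i (jln f) = jmult (jdiff i f) (jinv f)"
  by (rule ext) simp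

lemma jmult_jdiff_jln:
  assumes "f [] \<noteq> 0"
  shows "jmult f (jdiff i (jln f)) = jdiff i f"
proof -
  have "jmult f (jdiff i (jln f)) = jmult (jmult f (jinv f)) (jdiff i f)" unfolding jdiff_jln by (simp only: jmult_ac)
  also have "jmult f (jinv f) = unit_jet" using jmult_jinv[of f] assms(1) by auto
  finally show ?thesis by auto
qed

subsection \<open>Jets of functions\<close>

lemma jmult_deriv:
  assumes "\<And>s. length s \<le> length l \<Longrightarrow> ((\<lambda>t. b t s) has_field_derivative b' s) (at x)"
    and "\<And>s. length s \<le> length l \<Longrightarrow> ((\<lambda>t. c t s) has_field_derivative c' s) (at x)"
  shows "((\<lambda>t. jmult (b t) (c t) l) has_field_derivative
           jmult b' (c x) l + jmult (b x) c' l) (at (x::real))"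
  using assms
proof (induction l arbitrary: b b' c c')
  case Nil
  then show ?case by (auto intro!: derivative_eq_intros)
next
  case (Cons i l)
  have "((\<lambda>t. jmult (jdiff i (b t)) (c t) l) has_field_derivative
           jmult (jdiff i b') (c x) l + jmult (jdiff i (b x)) c' l) (at x)"
       "((\<lambda>t. jmult (b t) (jdiff i (c t)) l) has_field_derivative
           jmult b' (jdiff i (c x)) l + jmult (b x) (jdiff i c') l) (at x)"
    by (rule Cons.IH; simp add: Cons.prems)+
  from DERIV_add[OF this] show ?case by (simp add: algebra_simps)
qed

lemma jinv_deriv:
  assumes "\<And>s. ((\<lambda>t. f t s) has_field_derivative f' s) (at x)" "f x [] \<noteq> 0"
  shows "((\<lambda>t. jinv (f t) l) has_field_derivative
           - jmult f' (jmult (jinv (f x)) (jinv (f x))) l) (at (x::real))"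
proof (induction l rule: length_induct)
  case (1 l)
  show ?case
  proof (cases l)
    case Nil
    then show ?thesis using assms by (auto intro!: derivative_eq_intros simp: power2_eq_square)
  next
    case (Cons i k)
    let ?g = "jinv (f x)" and ?g' = "\<lambda>l. - jmult f' (jmult (jinv (f x)) (jinv (f x))) l"
    have g: "((\<lambda>t. jinv (f t) s) has_field_derivative ?g' s) (at x)" if "length s \<le> length k" for s
      using 1 Cons that by simp
    have gg: "((\<lambda>t. jmult (jinv (f t)) (jinv (f t)) s) has_field_derivative
          jmult ?g' ?g s + jmult ?g ?g' s) (at x)" if "length s \<le> length k" for s
      by (intro jmult_deriv g) (use that in auto)
    have "((\<lambda>t. - jmult (jdiff i (f t)) (jmult (jinv (f t)) (jinv (f t))) k) has_field_derivative
      - (jmult (jdiff i f') (jmult ?g ?g) k + jmult (jdiff i (f x)) (\<lambda>s. jmult ?g' ?g s + jmult ?g ?g' s) k)) (at x)"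
      by (intro DERIV_minus jmult_deriv gg) (use assms in auto)
    then show ?thesis using Cons
      by (simp add: jmult_add_right jmult_minus_right jmult_minus_left jmult_add_left jmult_scale_right jmult_ac)
  qed
qed

text \<open>Openness along coordinate lines only, which is all that \<open>pdiff\<close> sees. Boxes
  restricting infinitely many coordinates have this property, though they need not be open in the
  product topology.\<close>

definition copen :: "(nat \<Rightarrow> real) set \<Rightarrow> bool" where
  "copen U \<longleftrightarrow> (\<forall>p\<in>U. \<forall>i. \<forall>\<^sub>F t in nhds (p i). p(i := t) \<in> U)"

definition jet_on :: "(nat \<Rightarrow> real) set \<Rightarrow> ((nat \<Rightarrow> real) \<Rightarrow> nat list \<Rightarrow> real) \<Rightarrow> bool" where
  "jet_on U b \<longleftrightarrow> (\<forall>p\<in>U. \<forall>i l.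
     ((\<lambda>t. b (p(i := t)) l) has_field_derivative b p (i # l)) (at (p i)))"

lemma jet_onD:
  "jet_on U b \<Longrightarrow> p \<in> U \<Longrightarrow>
     ((\<lambda>t. b (p(i := t)) l) has_field_derivative b p (i # l)) (at (p i))"
  by (simp add: jet_on_def)

lemma jet_on_jmult:
  assumes "jet_on U b" "jet_on U c"
  shows "jet_on U (\<lambda>p. jmult (b p) (c p))"
  unfolding jet_on_def
proof (intro ballI allI)
  fix p i l assume p: "p \<in> U"
  show "((\<lambda>t. jmult (b (p(i := t))) (c (p(i := t))) l) has_field_derivative
          jmult (b p) (c p) (i # l)) (at (p i))"
    using jmult_deriv[of l "\<lambda>t. b (p(i := t))" "jdiff i (b p)" "p i" "\<lambda>t. c (p(i := t))" "jdiff i (c p)"]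
      jet_onD[OF assms(1) p] jet_onD[OF assms(2) p] by simp
qed

lemma jet_on_jln:
  assumes f: "jet_on U f" and pos: "\<And>p. p \<in> U \<Longrightarrow> f p [] > 0"
  shows "jet_on U (\<lambda>p. jln (f p))"
  unfolding jet_on_def
proof (intro ballI allI)
  fix p i l assume p: "p \<in> U"
  note d = jet_onD[OF f p]
  have nz: "f (p(i := p i)) [] \<noteq> 0" using pos[OF p] by simp
  show "((\<lambda>t. jln (f (p(i := t))) l) has_field_derivative jln (f p) (i # l)) (at (p i))"
  proof (cases l)
    case Nil
    show ?thesis unfolding Nil using d[of i "[]"] pos[OF p]
      by (auto intro!: derivative_eq_intros)
  next
    case (Cons j k)
    have inv: "((\<lambda>t. jinv (f (p(i := t))) s) has_field_derivative
        - jmult (jdiff i (f p)) (jmult (jinv (f p)) (jinv (f p))) s) (at (p i))" for s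
      using jinv_deriv[of "\<lambda>t. f (p(i := t))" "jdiff i (f p)" "p i" s] d nz by simp
    have "((\<lambda>t. jmult (jdiff j (f (p(i := t)))) (jinv (f (p(i := t)))) k) has_field_derivative
       jmult (jdiff j (jdiff i (f p))) (jinv (f (p(i := p i)))) k
       + jmult (jdiff j (f (p(i := p i)))) (\<lambda>l. - jmult (jdiff i (f p))
            (jmult (jinv (f p)) (jinv (f p))) l) k) (at (p i))"
      by (intro jmult_deriv inv) (rule d)
    then show ?thesis unfolding Cons
      by (simp add: jmult_minus_right jmult_ac)
  qed
qed

lemma copen_continuous:
  assumes "copen U" "\<And>p i. p \<in> U \<Longrightarrow> isCont (\<lambda>t. f (p(i := t))) (p i)"
  shows "copen {p \<in> U. f p > (0::real)}"
  unfolding copen_def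
proof (intro ballI allI)
  fix p i assume "p \<in> {p \<in> U. f p > 0}"
  then have p: "p \<in> U" "f p > 0" by auto
  have "((\<lambda>t. f (p(i := t))) \<longlongrightarrow> f p) (nhds (p i))"
    using assms(2)[OF p(1), of i] by (simp add: continuous_at tendsto_nhds_iff)
  from order_tendstoD(1)[OF this p(2)]
  show "\<forall>\<^sub>F t in nhds (p i). p(i := t) \<in> {p \<in> U. f p > 0}"
    using assms(1) p(1) unfolding copen_def by (simp add: eventually_conj_iff)
qed

section \<open>Domination and termwise differentiation of infinite sums\<close>

lemma summable_on_dominated:
  fixes f g :: "'a \<Rightarrow> real"
  assumes "g summable_on A" "\<And>x. x \<in> A \<Longrightarrow> \<bar>f x\<bar> \<le> g x"
  shows "f summable_on A"
proof (rule abs_summable_summable)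
  show "(\<lambda>x. norm (f x)) summable_on A"
    by (rule Infinite_Sum.abs_summable_on_comparison_test'[OF assms(1)]) (use assms(2) in auto)
qed

text \<open>By the mean value inequality the difference quotients inherit the bound
  \<open>\<beta> m\<close>. The Weierstrass test then makes their sum converge uniformly near
  \<open>x\<close>, so the limit may be taken termwise.\<close>

lemma infsum_deriv:
  fixes g :: "'a \<Rightarrow> real \<Rightarrow> real"
  assumes "\<forall>\<^sub>F t in nhds x. \<forall>m\<in>I. (g m has_field_derivative g' m t) (at t) \<and> \<bar>g' m t\<bar> \<le> \<beta> m"
    and "\<forall>\<^sub>F t in nhds x. (\<lambda>m. g m t) summable_on I"
    and "\<beta> summable_on I"
  shows "((\<lambda>t. \<Sum>\<^sub>\<infinity>m\<in>I. g m t) has_field_derivative (\<Sum>\<^sub>\<infinity>m\<in>I. g' m x)) (at x)"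
proof -
  from eventually_conj[OF assms(1,2)] obtain e where e: "e > 0" and
    H: "\<And>t. dist t x < e \<Longrightarrow> (\<forall>m\<in>I. (g m has_field_derivative g' m t) (at t) \<and> \<bar>g' m t\<bar> \<le> \<beta> m)
      \<and> (\<lambda>m. g m t) summable_on I"
    unfolding eventually_nhds_metric by blast
  define Q where "Q m t = (g m t - g m x) / (t - x)" for m t
  have Qb: "\<bar>Q m t\<bar> \<le> \<beta> m" if "m \<in> I" "t \<in> ball x e - {x}" for m t
  proof -
    have "\<bar>g m t - g m x\<bar> \<le> \<beta> m * \<bar>t - x\<bar>"
      using field_differentiable_bound[of "ball x e" "g m" "g' m" "\<beta> m" t x] H that e
      by (force simp: dist_commute intro: has_field_derivative_at_within)
    then show ?thesis using that by (simp add: Q_def divide_le_eq abs_mult field_simps)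
  qed
  have U: "uniform_limit (ball x e - {x}) (\<lambda>X t. \<Sum>m\<in>X. Q m t) (\<lambda>t. \<Sum>\<^sub>\<infinity>m\<in>I. Q m t)
      (finite_subsets_at_top I)"
    by (rule Weierstrass_m_test_general[where M=\<beta>]) (use Qb assms(3) in auto)
  have bs: "(\<lambda>m. g' m x) summable_on I"
    by (rule summable_on_dominated[OF assms(3)]) (use H[of x] e in auto)
  have "((\<lambda>t. \<Sum>\<^sub>\<infinity>m\<in>I. Q m t) \<longlongrightarrow> (\<Sum>\<^sub>\<infinity>m\<in>I. g' m x)) (at x within (ball x e - {x}))"
  proof (rule swap_uniform_limit[OF _ _ U])
    have D: "((\<lambda>t. Q m t) \<longlongrightarrow> g' m x) (at x within ball x e - {x})" if "m \<in> I" for m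
    proof -
      have "(g m has_field_derivative g' m x) (at x)" using H[of x] e that by auto
      then show ?thesis unfolding has_field_derivative_iff Q_def
        by (rule tendsto_within_subset) auto
    qed
    show "\<forall>\<^sub>F X in finite_subsets_at_top I.
       ((\<lambda>t. \<Sum>m\<in>X. Q m t) \<longlongrightarrow> (\<Sum>m\<in>X. g' m x)) (at x within ball x e - {x})"
      by (rule eventually_finite_subsets_at_top_weakI) (intro tendsto_sum D, auto)
    show "((\<lambda>X. \<Sum>m\<in>X. g' m x) \<longlongrightarrow> (\<Sum>\<^sub>\<infinity>m\<in>I. g' m x)) (finite_subsets_at_top I)"
      using has_sum_infsum[OF bs] by (simp add: has_sum_def)
    show "finite_subsets_at_top I \<noteq> bot" by simp
  qed
  then have "((\<lambda>t. \<Sum>\<^sub>\<infinity>m\<in>I. Q m t) \<longlongrightarrow> (\<Sum>\<^sub>\<infinity>m\<in>I. g' m x)) (at x)"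
    using at_within_open[of x "ball x e"] e by (simp add: at_within_def)
  then show ?thesis unfolding has_field_derivative_iff
  proof (rule Lim_transform_eventually)
    show "\<forall>\<^sub>F t in at x. (\<Sum>\<^sub>\<infinity>m\<in>I. Q m t) = ((\<Sum>\<^sub>\<infinity>m\<in>I. g m t) - (\<Sum>\<^sub>\<infinity>m\<in>I. g m x)) / (t - x)"
      unfolding eventually_at
    proof (intro exI[of _ e] conjI e ballI impI)
      fix t assume t: "t \<noteq> x \<and> dist t x < e"
      then have "(\<lambda>m. g m t) summable_on I" "(\<lambda>m. g m x) summable_on I" using H e by auto
      then have "(\<Sum>\<^sub>\<infinity>m\<in>I. g m t - g m x) = (\<Sum>\<^sub>\<infinity>m\<in>I. g m t) - (\<Sum>\<^sub>\<infinity>m\<in>I. g m x)"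
        using infsumI[OF has_sum_add[OF has_sum_infsum has_sum_uminusI[OF has_sum_infsum]],
            of "\<lambda>m. g m t" I "\<lambda>m. g m x"] by simp
      then show "(\<Sum>\<^sub>\<infinity>m\<in>I. Q m t) = ((\<Sum>\<^sub>\<infinity>m\<in>I. g m t) - (\<Sum>\<^sub>\<infinity>m\<in>I. g m x)) / (t - x)"
        unfolding Q_def divide_inverse by (simp add: infsum_cmult_left')
    qed
  qed
qed

text \<open>Model case: \<open>A * prod_list (map \<beta> s)\<close> is the jet at 0 of A exp(\<Sum>
  \<beta> i x_i), and exponentials multiply by adding their exponents.\<close>

lemma jmult_bound:
  assumes "\<And>s. length s \<le> length l \<Longrightarrow> \<bar>b s\<bar> \<le> A * prod_list (map \<beta> s)"
    and "\<And>s. length s \<le> length l \<Longrightarrow> \<bar>c s\<bar> \<le> A' * prod_list (map \<beta>' s)"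
  shows "\<bar>jmult b c l\<bar> \<le> A * A' * prod_list (map (\<lambda>i. \<beta> i + \<beta>' i) l)"
  using assms
proof (induction l arbitrary: b c A A')
  case Nil
  then show ?case using Nil[of "[]"] by (auto simp: abs_mult intro!: mult_mono)
next
  case (Cons i l)
  have "\<bar>jmult (jdiff i b) c l\<bar> \<le> (A * \<beta> i) * A' * prod_list (map (\<lambda>i. \<beta> i + \<beta>' i) l)"
    by (rule Cons.IH) (use Cons.prems(1)[of "i # _"] Cons.prems(2) in \<open>auto simp: mult_ac\<close>)
  moreover have "\<bar>jmult b (jdiff i c) l\<bar> \<le> A * (A' * \<beta>' i) * prod_list (map (\<lambda>i. \<beta> i + \<beta>' i) l)"
    by (rule Cons.IH) (use Cons.prems(2)[of "i # _"] Cons.prems(1) in \<open>auto simp: mult_ac\<close>)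
  ultimately show ?case by (simp add: algebra_simps)
qed

lemma jmult_has_sum:
  assumes "\<And>s. ((\<lambda>m. u m s) has_sum v s) I"
  shows "((\<lambda>m. jmult (u m) c l) has_sum jmult v c l) I"
  using assms
proof (induction l arbitrary: u v c)
  case Nil
  then show ?case by (auto intro!: has_sum_cmult_left)
next
  case (Cons i l)
  show ?case unfolding jmult.simps
    by (intro has_sum_add Cons.IH Cons.prems)
qed

lemma infsum_abs_le:
  fixes f g :: "'a \<Rightarrow> real"
  assumes "g summable_on A" "\<And>x. x \<in> A \<Longrightarrow> \<bar>f x\<bar> \<le> g x"
  shows "\<bar>\<Sum>\<^sub>\<infinity>x\<in>A. f x\<bar> \<le> (\<Sum>\<^sub>\<infinity>x\<in>A. g x)"
proof -
  have f: "f summable_on A" by (rule summable_on_dominated[OF assms])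
  have "(\<Sum>\<^sub>\<infinity>x\<in>A. f x) \<le> (\<Sum>\<^sub>\<infinity>x\<in>A. g x)"
    by (rule infsum_mono[OF f assms(1)]) (use assms(2) abs_le_D1 in blast)
  moreover have "(\<lambda>x. - g x) summable_on A"
    using summable_on_cmult_right[OF assms(1), of "-1"] by simp
  then have "(\<Sum>\<^sub>\<infinity>x\<in>A. - g x) \<le> (\<Sum>\<^sub>\<infinity>x\<in>A. f x)"
    by (rule infsum_mono[OF _ f]) (use assms(2) in \<open>auto dest: abs_le_D2 simp: minus_le_iff\<close>)
  ultimately show ?thesis by (simp add: infsum_uminus abs_le_iff)
qed

subsection \<open>Geometrically decaying jets\<close>

text \<open>The constant may depend on the order \<open>n\<close>: a product costs a factor 2 for
  each derivative, so a bound uniform in the order would not survive multiplication.\<close>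

definition geom :: "real \<Rightarrow> nat \<Rightarrow> (nat list \<Rightarrow> real) \<Rightarrow> bool" where
  "geom \<rho> n f \<longleftrightarrow> (\<exists>C. \<forall>s. length s \<le> n \<longrightarrow> \<bar>f s\<bar> \<le> C * \<rho> ^ sum_list s)"

lemma prod_list_power: "prod_list (map (\<lambda>i. (\<rho>::real) ^ i) s) = \<rho> ^ sum_list s"
  by (induction s) (simp_all add: power_add)

lemma prod_list_two_power:
  "prod_list (map (\<lambda>i. (\<rho>::real) ^ i + \<rho> ^ i) s) = 2 ^ length s * \<rho> ^ sum_list s"
  by (induction s) (simp_all add: power_add)

lemma jmult_geom_bound:
  assumes "0 \<le> \<rho>" "0 \<le> A * A'"
    and "\<And>s. length s \<le> n \<Longrightarrow> \<bar>b s\<bar> \<le> A * \<rho> ^ sum_list s"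
    and "\<And>s. length s \<le> n \<Longrightarrow> \<bar>c s\<bar> \<le> A' * \<rho> ^ sum_list s"
    and "length l \<le> n"
  shows "\<bar>jmult b c l\<bar> \<le> A * A' * 2 ^ n * \<rho> ^ sum_list l"
proof -
  have "\<bar>jmult b c l\<bar> \<le> A * A' * prod_list (map (\<lambda>i. \<rho> ^ i + \<rho> ^ i) l)"
    by (rule jmult_bound) (use assms in \<open>auto simp: prod_list_power\<close>)
  also have "\<dots> \<le> A * A' * (2 ^ n * \<rho> ^ sum_list l)"
    unfolding prod_list_two_power using assms
    by (intro mult_left_mono mult_right_mono power_increasing) auto
  finally show ?thesis by (simp add: mult_ac)
qed

lemma geom_bound_nonneg:
  assumes "\<forall>s. length s \<le> n \<longrightarrow> \<bar>f s\<bar> \<le> C * \<rho> ^ sum_list s"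
  shows "0 \<le> (C::real)"
  using assms[rule_format, of "[]"] by simp

lemma geom_jmult:
  assumes "0 \<le> \<rho>" "geom \<rho> n f" "geom \<rho> n g"
  shows "geom \<rho> n (jmult f g)"
proof -
  obtain C D where *: "\<forall>s. length s \<le> n \<longrightarrow> \<bar>f s\<bar> \<le> C * \<rho> ^ sum_list s"
    "\<forall>s. length s \<le> n \<longrightarrow> \<bar>g s\<bar> \<le> D * \<rho> ^ sum_list s"
    using assms(2,3) unfolding geom_def by blast
  have "\<bar>jmult f g l\<bar> \<le> C * D * 2 ^ n * \<rho> ^ sum_list l" if "length l \<le> n" for l
    by (rule jmult_geom_bound) (use * that assms geom_bound_nonneg[OF *(1)] geom_bound_nonneg[OF *(2)] in auto)
  then show ?thesis unfolding geom_def by blast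
qed

text \<open>Common induction step for \<open>jinv\<close> and \<open>jln\<close>: one derivative
  falls on \<open>f\<close>, so \<open>g\<close> is needed only up to order \<open>n\<close>. The
  absolute values absorb the sign in \<open>jinv\<close>.\<close>

lemma geom_Suc:
  assumes "0 \<le> \<rho>" "geom \<rho> (Suc n) f" "geom \<rho> n g"
    and h: "\<And>i s. \<bar>h (i # s)\<bar> = \<bar>jmult (jdiff i f) g s\<bar>"
  shows "geom \<rho> (Suc n) h"
proof -
  obtain C D where *: "\<forall>s. length s \<le> Suc n \<longrightarrow> \<bar>f s\<bar> \<le> C * \<rho> ^ sum_list s"
    "\<forall>s. length s \<le> n \<longrightarrow> \<bar>g s\<bar> \<le> D * \<rho> ^ sum_list s"
    using assms(2,3) unfolding geom_def by blast
  have CD: "0 \<le> C" "0 \<le> D"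
    using geom_bound_nonneg[OF *(1)] geom_bound_nonneg[OF *(2)] by auto
  have "\<bar>h l\<bar> \<le> (\<bar>h []\<bar> + C * D * 2 ^ n) * \<rho> ^ sum_list l" if l: "length l \<le> Suc n" for l
  proof (cases l)
    case Nil
    then show ?thesis using CD by simp
  next
    case (Cons i s)
    have "\<bar>jmult (jdiff i f) g s\<bar> \<le> (C * \<rho> ^ i) * D * 2 ^ n * \<rho> ^ sum_list s"
    proof (rule jmult_geom_bound)
      show "\<bar>f (i # t)\<bar> \<le> C * \<rho> ^ i * \<rho> ^ sum_list t" if "length t \<le> n" for t
        using *(1)[rule_format, of "i # t"] that by (simp add: power_add mult_ac)
    qed (use * CD assms l Cons in auto)
    also have "\<dots> = C * D * 2 ^ n * \<rho> ^ sum_list l" using Cons by (simp add: power_add)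
    also have "\<dots> \<le> (\<bar>h []\<bar> + C * D * 2 ^ n) * \<rho> ^ sum_list l"
      using assms(1) by (intro mult_right_mono) auto
    finally show ?thesis using h Cons by simp
  qed
  then show ?thesis unfolding geom_def by blast
qed

lemma geom_0: "geom \<rho> 0 f"
  unfolding geom_def by (intro exI[of _ "\<bar>f []\<bar>"]) auto

lemma geom_jinv:
  assumes "0 \<le> \<rho>" "\<And>n. geom \<rho> n f"
  shows "geom \<rho> n (jinv f)"
proof (induction n)
  case (Suc n)
  show ?case
    by (rule geom_Suc[OF assms(1,2) geom_jmult[OF assms(1) Suc Suc]]) simp
qed (simp add: geom_0)

lemma geom_jln:
  assumes "0 \<le> \<rho>" "\<And>n. geom \<rho> n f"
  shows "geom \<rho> n (jln f)"
proof (cases n)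
  case (Suc m)
  show ?thesis unfolding Suc
    by (rule geom_Suc[OF assms(1,2) geom_jinv[OF assms, of m]]) simp
qed (simp add: geom_0)

section \<open>Polynomial weights against geometric decay\<close>

lemma poly_geometric_bound:
  fixes q :: real
  assumes "0 < q" "q < 1"
  obtains C \<sigma> where "0 < \<sigma>" "\<sigma> < 1" "0 < C" "\<And>n. real n ^ k * q ^ n \<le> C * \<sigma> ^ n"
proof -
  \<comment> \<open>With this root, q^n consists of k + 1 copies of \<sigma>^n: k of them tame n^k,
    the last one remains as decay.\<close>
  define \<sigma> where "\<sigma> = root (Suc k) q"
  have \<sigma>: "0 < \<sigma>" "\<sigma> < 1" "\<sigma> ^ Suc k = q"
    using assms unfolding \<sigma>_def by (auto simp del: power_Suc)
  have "(\<lambda>n. real n * \<sigma> ^ n) \<longlonglongrightarrow> 0"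
    using powser_times_n_limit_0[of \<sigma>] \<sigma> by simp
  then have "Bseq (\<lambda>n. real n * \<sigma> ^ n)"
    using convergent_imp_Bseq convergent_def by blast
  then obtain K where K: "K > 0" "\<And>n. norm (real n * \<sigma> ^ n) \<le> K" unfolding Bseq_def by blast
  have "real n ^ k * q ^ n \<le> K ^ k * \<sigma> ^ n" for n
  proof -
    have "real n ^ k * q ^ n = (real n * \<sigma> ^ n) ^ k * \<sigma> ^ n"
      unfolding \<sigma>(3)[symmetric] by (simp add: power_mult_distrib mult.commute add.commute flip: power_mult power_add)
    also have "\<dots> \<le> K ^ k * \<sigma> ^ n"
      using K(2)[of n] \<sigma> by (intro mult_right_mono power_mono) auto
    finally show ?thesis .
  qed
  with \<sigma> K show ?thesis by (intro that[of \<sigma> "K ^ k"]) auto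
qed

lemma choose_le_power: "n choose k \<le> n ^ k"
  by (cases "k \<le> n") (simp_all add: binomial_le_pow binomial_eq_0)

lemma choose_geometric_summable:
  assumes "0 < \<rho>" "\<rho> < (1::real)"
  shows "(\<lambda>i. real (i choose k) * \<rho> ^ i) summable_on A"
proof -
  obtain C \<sigma> where *: "0 < \<sigma>" "\<sigma> < 1" "\<And>n. real n ^ k * \<rho> ^ n \<le> C * \<sigma> ^ n"
    using poly_geometric_bound[OF assms, of k] by blast
  have "(\<lambda>i. C * \<sigma> ^ i) summable_on A"
    by (rule summable_on_subset_banach[of _ UNIV])
       (use * in \<open>auto simp: abs_mult intro!: norm_summable_imp_summable_on summable_mult\<close>)
  then show ?thesis
  proof (rule summable_on_dominated)
    fix i
    have "real (i choose k) * \<rho> ^ i \<le> real i ^ k * \<rho> ^ i"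
      using assms choose_le_power by (intro mult_right_mono) (auto simp flip: of_nat_power)
    also note *(3)[of i]
    finally show "\<bar>real (i choose k) * \<rho> ^ i\<bar> \<le> C * \<sigma> ^ i"
      using assms by simp
  qed
qed

subsection \<open>The linear substitution with binomial coefficients\<close>

text \<open>For \<open>p\<^sub>i = N + \<Sum>\<^sub>k binom(i,k) y\<^sub>k\<close> one has \<open>\<partial>/\<partial>y\<^sub>k = \<Sum>\<^sub>i binom(i,k) \<partial>/\<partial>p\<^sub>i\<close>, which is \<open>bdiff k\<close>;
  \<open>binom_subst\<close> passes from the \<open>p\<close>-derivatives to the \<open>y\<close>-derivatives.\<close>

definition bdiff :: "nat \<Rightarrow> (nat list \<Rightarrow> real) \<Rightarrow> nat list \<Rightarrow> real" where
  "bdiff k f s = (\<Sum>\<^sub>\<infinity>i. real (i choose k) * f (i # s))"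

fun binom_subst :: "(nat list \<Rightarrow> real) \<Rightarrow> nat list \<Rightarrow> real" where
  "binom_subst f [] = f []"
| "binom_subst f (k # ks) = binom_subst (bdiff k f) ks"

lemma bdiff_term_bound:
  fixes \<rho> :: real
  assumes "\<bar>f (i # s)\<bar> \<le> C * \<rho> ^ sum_list (i # s)"
  shows "\<bar>real (i choose k) * f (i # s)\<bar> \<le> (C * \<rho> ^ sum_list s) * (real (i choose k) * \<rho> ^ i)"
proof -
  have "real (i choose k) * \<bar>f (i # s)\<bar> \<le> real (i choose k) * (C * \<rho> ^ sum_list (i # s))"
    using assms by (intro mult_left_mono) auto
  then show ?thesis by (simp add: abs_mult power_add mult_ac)
qed

context
  fixes \<rho> :: real
  assumes \<rho>: "0 < \<rho>" "\<rho> < 1"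
begin

lemma geom_summable:
  assumes "geom \<rho> (Suc n) f" "length s \<le> n"
  shows "(\<lambda>i. real (i choose k) * f (i # s)) summable_on A"
proof -
  obtain C where C: "\<And>s. length s \<le> Suc n \<Longrightarrow> \<bar>f s\<bar> \<le> C * \<rho> ^ sum_list s"
    using assms(1) unfolding geom_def by blast
  have "(\<lambda>i. (C * \<rho> ^ sum_list s) * (real (i choose k) * \<rho> ^ i)) summable_on A"
    by (intro summable_on_cmult_right choose_geometric_summable \<rho>)
  then show ?thesis
    by (rule summable_on_dominated) (intro bdiff_term_bound C, use assms(2) in simp)
qed

lemma bdiff_has_sum:
  assumes "\<And>n. geom \<rho> n f"
  shows "((\<lambda>i. real (i choose k) * f (i # s)) has_sum bdiff k f s) UNIV"
  unfolding bdiff_def using geom_summable[OF assms order_refl] by (rule has_sum_infsum)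

lemma geom_bdiff:
  assumes "geom \<rho> (Suc n) f"
  shows "geom \<rho> n (bdiff k f)"
proof -
  obtain C where C: "\<And>s. length s \<le> Suc n \<Longrightarrow> \<bar>f s\<bar> \<le> C * \<rho> ^ sum_list s"
    using assms(1) unfolding geom_def by blast
  define S where "S = (\<Sum>\<^sub>\<infinity>i. real (i choose k) * \<rho> ^ i)"
  have "\<bar>bdiff k f s\<bar> \<le> (C * S) * \<rho> ^ sum_list s" if s: "length s \<le> n" for s
  proof -
    have "\<bar>bdiff k f s\<bar> \<le> (\<Sum>\<^sub>\<infinity>i. (C * \<rho> ^ sum_list s) * (real (i choose k) * \<rho> ^ i))"
      unfolding bdiff_def
      by (intro infsum_abs_le summable_on_cmult_right choose_geometric_summable \<rho> bdiff_term_bound C)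
         (use s in simp)
    also have "\<dots> = (C * S) * \<rho> ^ sum_list s"
      unfolding S_def by (subst infsum_cmult_right') (simp add: mult_ac)
    finally show ?thesis .
  qed
  then show ?thesis unfolding geom_def by blast
qed

lemma bdiff_add:
  assumes "\<And>n. geom \<rho> n f" "\<And>n. geom \<rho> n g"
  shows "bdiff k (\<lambda>s. f s + g s) = (\<lambda>s. bdiff k f s + bdiff k g s)"
proof
  fix s
  show "bdiff k (\<lambda>s. f s + g s) s = bdiff k f s + bdiff k g s"
    using has_sum_add[OF bdiff_has_sum[OF assms(1)] bdiff_has_sum[OF assms(2)], THEN infsumI, of k s k s]
    by (simp add: bdiff_def distrib_left)
qed

lemma bdiff_jmult:
  assumes f: "\<And>n. geom \<rho> n f" and g: "\<And>n. geom \<rho> n g"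
  shows "bdiff k (jmult f g) = (\<lambda>s. jmult (bdiff k f) g s + jmult f (bdiff k g) s)"
proof
  fix s
  have 1: "((\<lambda>i. jmult (\<lambda>s. real (i choose k) * f (i # s)) g s) has_sum jmult (bdiff k f) g s) UNIV"
    by (intro jmult_has_sum bdiff_has_sum f)
  have 2: "((\<lambda>i. jmult (\<lambda>s. real (i choose k) * g (i # s)) f s) has_sum jmult (bdiff k g) f s) UNIV"
    by (intro jmult_has_sum bdiff_has_sum g)
  show "bdiff k (jmult f g) s = jmult (bdiff k f) g s + jmult f (bdiff k g) s"
    using has_sum_add[OF 1 2, THEN infsumI]
    by (simp add: bdiff_def jmult_scale_left distrib_left jmult_comm[of f])
qed

lemma binom_subst_add:
  assumes "\<And>n. geom \<rho> n f" "\<And>n. geom \<rho> n g"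
  shows "binom_subst (\<lambda>s. f s + g s) ks = binom_subst f ks + binom_subst g ks"
  using assms by (induction ks arbitrary: f g) (simp_all add: bdiff_add geom_bdiff)

lemma binom_subst_jmult:
  assumes "\<And>n. geom \<rho> n f" "\<And>n. geom \<rho> n g"
  shows "binom_subst (jmult f g) ks = jmult (binom_subst f) (binom_subst g) ks"
  using assms
proof (induction ks arbitrary: f g)
  case (Cons k ks)
  then show ?case using \<rho> by (simp add: bdiff_jmult binom_subst_add geom_bdiff geom_jmult)
qed simp

text \<open>The equation f \<partial>(ln f) = \<partial>f, summed over all p-directions with
  binomial weights; the decay of \<open>jln f\<close> allows the sum to enter the product.\<close>

lemma jmult_bdiff_jln:
  assumes f: "\<And>n. geom \<rho> n f" and nz: "f [] \<noteq> 0"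
  shows "jmult f (bdiff k (jln f)) = bdiff k f"
proof
  fix s
  have "((\<lambda>i. jmult (\<lambda>s. real (i choose k) * jln f (i # s)) f s) has_sum jmult (bdiff k (jln f)) f s) UNIV"
    by (intro jmult_has_sum bdiff_has_sum geom_jln f less_imp_le \<rho>)
  then have "((\<lambda>i. real (i choose k) * jmult f (jdiff i (jln f)) s) has_sum jmult f (bdiff k (jln f)) s) UNIV"
    by (simp add: jmult_scale_left jmult_scale_right jmult_comm_fun del: jln.simps)
  then show "jmult f (bdiff k (jln f)) s = bdiff k f s"
    unfolding jmult_jdiff_jln[of f, OF nz] bdiff_def[of k f] by (simp add: infsumI)
qed

lemma binom_subst_jln:
  assumes f: "\<And>n. geom \<rho> n f" and nz: "f [] \<noteq> 0"
  shows "binom_subst (jln f) = jln (binom_subst f)"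
proof (rule jln_unique)
  fix k ks
  have "jmult (binom_subst f) (jdiff k (binom_subst (jln f))) ks = jmult (binom_subst f) (binom_subst (bdiff k (jln f))) ks" by simp
  also have "\<dots> = binom_subst (jmult f (bdiff k (jln f))) ks"
    by (rule binom_subst_jmult[symmetric]) (intro f geom_bdiff geom_jln less_imp_le \<rho>)+
  finally show "jmult (binom_subst f) (jdiff k (binom_subst (jln f))) ks = binom_subst f (k # ks)"
    using f nz by (simp add: jmult_bdiff_jln)
qed (use nz in auto)

section \<open>Iterated sums as sums over index tuples\<close>

lemma bij_betw_tuples_Suc:
  "bij_betw (\<lambda>(is, i). i # is) (tuples n \<times> {1..}) (tuples (Suc n))"
  by (rule bij_betw_byWitness[where f' = "\<lambda>l. (tl l, hd l)"])
     (auto simp: tuples_def length_Suc_conv)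

lemma tuples_weight_summable:
  "(\<lambda>is. \<Prod>j<length ks. real (is ! j choose ks ! j) * \<rho> ^ (is ! j)) summable_on tuples (length ks)"
proof (induction ks)
  case Nil
  have "tuples 0 = {[]}" by (auto simp: tuples_def)
  then show ?case by simp
next
  case (Cons k ks)
  let ?w = "\<lambda>is. \<Prod>j<length ks. real (is ! j choose ks ! j) * \<rho> ^ (is ! j)"
  have "(\<lambda>(is, i). (real (i choose k) * \<rho> ^ i) * ?w is) summable_on (tuples (length ks) \<times> {1..})"
  proof (rule summable_on_SigmaI)
    show "((\<lambda>y. case (is, y) of (is, i) \<Rightarrow> (real (i choose k) * \<rho> ^ i) * ?w is) has_sum
        ((\<Sum>\<^sub>\<infinity>i\<in>{1..}. real (i choose k) * \<rho> ^ i) * ?w is)) {1..}" for "is"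
      by (auto intro!: has_sum_cmult_left has_sum_infsum choose_geometric_summable \<rho>)
  qed (use \<rho> in \<open>auto intro!: summable_on_cmult_right Cons.IH mult_nonneg_nonneg prod_nonneg\<close>)
  then have "(\<lambda>l. \<Prod>j<length (k # ks). real (l ! j choose (k # ks) ! j) * \<rho> ^ (l ! j)) \<circ> (\<lambda>(is, i). i # is)
      summable_on (tuples (length ks) \<times> {1..})"
    by (simp add: o_def case_prod_unfold prod.lessThan_Suc_shift del: prod.lessThan_Suc)
  then show ?case
    using summable_on_reindex_bij_betw[OF bij_betw_tuples_Suc[of "length ks"],
      of "\<lambda>l. \<Prod>j<length (k # ks). real (l ! j choose (k # ks) ! j) * \<rho> ^ (l ! j)"]
    by (simp add: o_def del: prod.lessThan_Suc)
qed

lemma prod_power_sum_list: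
  "length is = n \<Longrightarrow> (\<Prod>j<n. (\<rho>::real) ^ (is ! j)) = \<rho> ^ sum_list is"
  by (simp add: power_sum[symmetric] sum_list_sum_nth atLeast0LessThan)

text \<open>Links the iterated sums of \<open>binom_subst\<close> with the unordered sum in
  \<open>Dsum\<close>. Absolute summability is established first, so that the first index can be
  split off by Fubini.\<close>

lemma binom_subst_has_sum:
  assumes "\<And>n. geom \<rho> n g" "\<forall>k\<in>set ks. 1 \<le> k"
  shows "((\<lambda>is. (\<Prod>j<length ks. real (is ! j choose ks ! j)) * g is) has_sum binom_subst g ks)
           (tuples (length ks))"
  using assms
proof (induction ks arbitrary: g)
  case Nil
  have "tuples 0 = {[]}" by (auto simp: tuples_def)
  then show ?case using has_sum_finite[of "{[]}" g] by simp
next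
  case (Cons k ks)
  define W where "W l is = (\<Prod>j<length l. real (is ! j choose l ! j))" for l "is" :: "nat list"
  obtain C where C: "\<And>s. length s \<le> length (k # ks) \<Longrightarrow> \<bar>g s\<bar> \<le> C * \<rho> ^ sum_list s"
    using Cons.prems(1)[of "length (k # ks)"] unfolding geom_def by blast
  have "(\<lambda>is. W (k # ks) is * g is) summable_on tuples (length (k # ks))"
  proof (rule summable_on_dominated[OF summable_on_cmult_right[OF tuples_weight_summable[of "k # ks"], of C]])
    fix "is" assume "is \<in> tuples (length (k # ks))"
    then have l: "length is = length (k # ks)" by (simp add: tuples_def)
    have "0 \<le> W (k # ks) is" unfolding W_def by (intro prod_nonneg) auto
    then have "\<bar>W (k # ks) is * g is\<bar> \<le> W (k # ks) is * (C * \<rho> ^ sum_list is)"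
      using C[of "is"] l by (auto simp: abs_mult intro!: mult_left_mono)
    also have "\<dots> = C * (\<Prod>j<length (k # ks). real (is ! j choose (k # ks) ! j) * \<rho> ^ (is ! j))"
      using prod_power_sum_list[OF l] by (simp add: W_def prod.distrib mult_ac del: prod.lessThan_Suc)
    finally show "\<bar>W (k # ks) is * g is\<bar> \<le> \<dots>" .
  qed
  then obtain a where a: "((\<lambda>is. W (k # ks) is * g is) has_sum a) (tuples (Suc (length ks)))"
    unfolding summable_on_def by auto
  then have a': "((\<lambda>(is, i). real (i choose k) * W ks is * g (i # is)) has_sum a) (tuples (length ks) \<times> {1..})"
    using has_sum_reindex_bij_betw[OF bij_betw_tuples_Suc[of "length ks"], of "\<lambda>is. W (k # ks) is * g is" a]
    by (simp add: case_prod_unfold W_def prod.lessThan_Suc_shift del: prod.lessThan_Suc)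
  have "((\<lambda>is. W ks is * bdiff k g is) has_sum a) (tuples (length ks))"
  proof (rule has_sum_Sigma'[OF a'])
    fix "is"
    have "((\<lambda>i. real (i choose k) * g (i # is)) has_sum bdiff k g is) {1..}"
    proof (rule has_sum_cong_neutral[THEN iffD1, OF _ _ _ bdiff_has_sum[OF Cons.prems(1)]])
      \<comment> \<open>\<open>bdiff\<close> also sums over the index 0, which \<open>tuples\<close>
        excludes; for k \<ge> 1 its weight binom(0,k) is 0.\<close>
      fix i :: nat assume "i \<in> UNIV - {1..}"
      then show "real (i choose k) * g (i # is) = 0" using Cons.prems(2) by (cases k) auto
    qed auto
    from has_sum_cmult_right[OF this, of "W ks is"]
    show "((\<lambda>i. case (is, i) of (is, i) \<Rightarrow> real (i choose k) * W ks is * g (i # is))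
            has_sum W ks is * bdiff k g is) {1..}"
      by (simp add: mult_ac)
  qed
  moreover have "((\<lambda>is. W ks is * bdiff k g is) has_sum binom_subst (bdiff k g) ks) (tuples (length ks))"
    unfolding W_def by (rule Cons.IH) (use Cons.prems geom_bdiff in auto)
  ultimately show ?case using a has_sum_unique by (fastforce simp: W_def)
qed

end

subsection \<open>Infinite sums of jets\<close>

text \<open>One majorant separates the two variables: \<open>\<alpha>\<close> carries summability
  over the monomials, and the rate \<open>\<rho>\<close> is common to all of them. This is what
  permits exchanging the sums over \<open>m\<close> and over indices.\<close>

definition geom_family :: "'a set \<Rightarrow> real \<Rightarrow> ('a \<Rightarrow> nat list \<Rightarrow> real) \<Rightarrow> bool" where
  "geom_family I \<rho> u \<longleftrightarrow> (\<forall>n. \<exists>\<alpha>. \<alpha> summable_on I \<and>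
     (\<forall>m\<in>I. \<forall>s. length s \<le> n \<longrightarrow> \<bar>u m s\<bar> \<le> \<alpha> m * \<rho> ^ sum_list s))"

lemma famE:
  assumes "geom_family I \<rho> u"
  obtains \<alpha> where "\<alpha> summable_on I"
    "\<And>m s. m \<in> I \<Longrightarrow> length s \<le> n \<Longrightarrow> \<bar>u m s\<bar> \<le> \<alpha> m * \<rho> ^ sum_list s"
    "\<And>m. m \<in> I \<Longrightarrow> 0 \<le> \<alpha> m"
proof -
  obtain \<alpha> where \<alpha>: "\<alpha> summable_on I"
    "\<And>m s. m \<in> I \<Longrightarrow> length s \<le> n \<Longrightarrow> \<bar>u m s\<bar> \<le> \<alpha> m * \<rho> ^ sum_list s"
    using assms[unfolded geom_family_def, THEN spec, of n] by (elim exE conjE) blast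
  have "0 \<le> \<alpha> m" if "m \<in> I" for m using \<alpha>(2)[OF that, of "[]"] by simp
  with \<alpha> show ?thesis using that by blast
qed

lemma geom_family_summable:
  assumes "geom_family I \<rho> u"
  shows "(\<lambda>m. u m s) summable_on I"
proof -
  obtain \<alpha> where \<alpha>: "\<alpha> summable_on I"
    "\<And>m t. m \<in> I \<Longrightarrow> length t \<le> length s \<Longrightarrow> \<bar>u m t\<bar> \<le> \<alpha> m * \<rho> ^ sum_list t"
    "\<And>m. m \<in> I \<Longrightarrow> 0 \<le> \<alpha> m"
    by (rule famE[OF assms, of "length s"]) (rule that)
  show ?thesis
    by (rule summable_on_dominated[OF summable_on_cmult_left[OF \<alpha>(1)] \<alpha>(2)[OF _ order_refl]])
qed

context
  fixes \<rho> :: real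
  assumes \<rho>: "0 < \<rho>" "\<rho> < 1"
begin

lemma geom_family_geom:
  assumes "geom_family I \<rho> u"
  shows "geom \<rho> n (\<lambda>s. \<Sum>\<^sub>\<infinity>m\<in>I. u m s)"
proof -
  obtain \<alpha> where \<alpha>: "\<alpha> summable_on I"
    "\<And>m s. m \<in> I \<Longrightarrow> length s \<le> n \<Longrightarrow> \<bar>u m s\<bar> \<le> \<alpha> m * \<rho> ^ sum_list s"
    "\<And>m. m \<in> I \<Longrightarrow> 0 \<le> \<alpha> m"
    by (rule famE[OF assms, of n]) (rule that)
  have "\<bar>\<Sum>\<^sub>\<infinity>m\<in>I. u m s\<bar> \<le> infsum \<alpha> I * \<rho> ^ sum_list s" if "length s \<le> n" for s
    using infsum_abs_le[of "\<lambda>m. \<alpha> m * \<rho> ^ sum_list s" I "\<lambda>m. u m s"] \<alpha> that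
    by (simp add: summable_on_cmult_left infsum_cmult_left')
  then show ?thesis unfolding geom_def by blast
qed

lemma geom_family_bdiff:
  assumes "geom_family I \<rho> u"
  shows "geom_family I \<rho> (\<lambda>m. bdiff k (u m))"
  unfolding geom_family_def
proof
  fix n
  obtain \<alpha> where \<alpha>: "\<alpha> summable_on I"
    "\<And>m s. m \<in> I \<Longrightarrow> length s \<le> Suc n \<Longrightarrow> \<bar>u m s\<bar> \<le> \<alpha> m * \<rho> ^ sum_list s"
    "\<And>m. m \<in> I \<Longrightarrow> 0 \<le> \<alpha> m"
    by (rule famE[OF assms, of "Suc n"]) (rule that)
  define S where "S = (\<Sum>\<^sub>\<infinity>i. real (i choose k) * \<rho> ^ i)"
  have "\<bar>bdiff k (u m) s\<bar> \<le> (\<alpha> m * S) * \<rho> ^ sum_list s" if "m \<in> I" "length s \<le> n" for m s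
  proof -
    have "\<bar>bdiff k (u m) s\<bar> \<le> (\<Sum>\<^sub>\<infinity>i. (\<alpha> m * \<rho> ^ sum_list s) * (real (i choose k) * \<rho> ^ i))"
      unfolding bdiff_def
      by (intro infsum_abs_le summable_on_cmult_right choose_geometric_summable \<rho> bdiff_term_bound)
         (use \<alpha>(2)[of m "_ # s"] that in auto)
    also have "\<dots> = (\<alpha> m * S) * \<rho> ^ sum_list s"
      unfolding S_def by (subst infsum_cmult_right') (simp add: mult_ac)
    finally show ?thesis .
  qed
  then show "\<exists>\<alpha>. \<alpha> summable_on I \<and>
     (\<forall>m\<in>I. \<forall>s. length s \<le> n \<longrightarrow> \<bar>bdiff k (u m) s\<bar> \<le> \<alpha> m * \<rho> ^ sum_list s)"
    using \<alpha>(1) by (intro exI[of _ "\<lambda>m. \<alpha> m * S"]) (auto intro: summable_on_cmult_left)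
qed

text \<open>The majorant on pairs \<open>(i, m)\<close> factors into a summable function of
  \<open>i\<close> and one of \<open>m\<close>, so Fubini applies.\<close>

lemma bdiff_infsum:
  assumes "geom_family I \<rho> u"
  shows "bdiff k (\<lambda>s. \<Sum>\<^sub>\<infinity>m\<in>I. u m s) = (\<lambda>s. \<Sum>\<^sub>\<infinity>m\<in>I. bdiff k (u m) s)"
proof
  fix s :: "nat list"
  obtain \<alpha> where \<alpha>: "\<alpha> summable_on I"
    "\<And>m t. m \<in> I \<Longrightarrow> length t \<le> Suc (length s) \<Longrightarrow> \<bar>u m t\<bar> \<le> \<alpha> m * \<rho> ^ sum_list t"
    "\<And>m. m \<in> I \<Longrightarrow> 0 \<le> \<alpha> m"
    by (rule famE[OF assms, of "Suc (length s)"]) (rule that)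
  let ?w = "\<lambda>i. real (i choose k) * \<rho> ^ i"
  have "(\<lambda>(i, m). (\<alpha> m * \<rho> ^ sum_list s) * ?w i) summable_on (UNIV \<times> I)"
  proof (rule summable_on_SigmaI)
    show "((\<lambda>m. case (i, m) of (i, m) \<Rightarrow> (\<alpha> m * \<rho> ^ sum_list s) * ?w i) has_sum
        infsum \<alpha> I * \<rho> ^ sum_list s * ?w i) I" for i
      using \<alpha>(1) by (auto intro!: has_sum_cmult_left has_sum_infsum)
    show "(\<lambda>i. infsum \<alpha> I * \<rho> ^ sum_list s * ?w i) summable_on UNIV"
      by (intro summable_on_cmult_right choose_geometric_summable \<rho>)
  qed (use \<alpha>(3) \<rho> in auto)
  then have "(\<lambda>(i, m). real (i choose k) * u m (i # s)) summable_on (UNIV \<times> I)"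
  proof (rule summable_on_dominated)
    fix z assume z: "z \<in> (UNIV :: nat set) \<times> I"
    obtain i m where "z = (i, m)" "m \<in> I" using z by blast
    with bdiff_term_bound[where f = "u m" and i = i and s = s and C = "\<alpha> m" and k = k] \<alpha>(2)[of m "i # s"]
    show "\<bar>case z of (i, m) \<Rightarrow> real (i choose k) * u m (i # s)\<bar>
        \<le> (case z of (i, m) \<Rightarrow> (\<alpha> m * \<rho> ^ sum_list s) * ?w i)"
      by simp
  qed
  from infsum_swap_banach[OF this]
  show "bdiff k (\<lambda>s. \<Sum>\<^sub>\<infinity>m\<in>I. u m s) s = (\<Sum>\<^sub>\<infinity>m\<in>I. bdiff k (u m) s)"
    by (simp add: bdiff_def infsum_cmult_right')
qed

lemma binom_subst_infsum:
  assumes "geom_family I \<rho> u"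
  shows "((\<lambda>m. binom_subst (u m) ks) has_sum binom_subst (\<lambda>s. \<Sum>\<^sub>\<infinity>m\<in>I. u m s) ks) I"
  using assms
proof (induction ks arbitrary: u)
  case Nil
  then show ?case using geom_family_summable[OF Nil, of "[]"] by (simp add: has_sum_infsum)
next
  case (Cons k ks)
  then show ?case using Cons.IH[OF geom_family_bdiff[OF Cons.prems], of k] by (simp add: bdiff_infsum)
qed

end

subsection \<open>The substitution of power sums\<close>

text \<open>Chain rule for \<open>y\<^sub>k = \<Sum>\<^sub>i u\<^sub>i^k\<close> at \<open>u = 0\<close>: only set partitions of the positions of a list
  into blocks carrying a single index \<open>i \<in> A\<close> contribute, a block of size \<open>k\<close> contributing \<open>k! \<partial>/\<partial>y\<^sub>k\<close>.
  \<open>ext i l\<close> lists the ways to complete the block of a first entry \<open>i\<close>, as (number of further entries, remainder).\<close>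

fun ext :: "nat \<Rightarrow> nat list \<Rightarrow> (nat \<times> nat list) list" where
  "ext i [] = [(0, [])]"
| "ext i (j # l) = map (\<lambda>(k, t). (k, j # t)) (ext i l)
     @ (if j = i then map (\<lambda>(k, t). (Suc k, t)) (ext i l) else [])"

lemma ext_length: "(k, t) \<in> set (ext i l) \<Longrightarrow> k + length t = length l"
  by (induction l arbitrary: k t) (auto split: if_splits)

lemma ext_set: "(k, t) \<in> set (ext i l) \<Longrightarrow> set t \<subseteq> set l \<and> set l \<subseteq> insert i (set t)"
  by (induction l arbitrary: k t) (force split: if_splits)+

text \<open>A pair \<open>(w, ks)\<close> represents one set partition: \<open>ks\<close> lists the
  block sizes in the order of first positions, and \<open>w\<close> is the product of their
  factorials. An index outside \<open>A\<close> gives no terms, since the y_k do not depend on that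
  variable.\<close>

function (sequential) terms :: "nat set \<Rightarrow> nat list \<Rightarrow> (real \<times> nat list) list" where
  "terms A [] = [(1, [])]"
| "terms A (i # l) = (if i \<in> A then concat (map (\<lambda>(k, t).
      map (\<lambda>(w, ks). (fact (Suc k) * w, Suc k # ks)) (terms A t)) (ext i l)) else [])"
  by pat_completeness auto
termination
  by (relation "inv_image less_than (\<lambda>(A, l). length l)") (auto dest: ext_length)

definition powsum_subst :: "nat set \<Rightarrow> (nat list \<Rightarrow> real) \<Rightarrow> nat list \<Rightarrow> real" where
  "powsum_subst A b l = (\<Sum>(w, ks)\<leftarrow>terms A l. w * b ks)"

lemma sum_list_concat_map: "sum_list (concat (map f xs)) = (\<Sum>x\<leftarrow>xs. sum_list (f x))"
  by (induction xs) simp_all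

lemma powsum_subst_Nil [simp]: "powsum_subst A b [] = b []"
  by (simp add: powsum_subst_def)

lemma powsum_subst_Cons:
  "powsum_subst A b (i # l) =
     (if i \<in> A then \<Sum>(k, t)\<leftarrow>ext i l. fact (Suc k) * powsum_subst A (jdiff (Suc k) b) t else 0)"
  by (auto simp: powsum_subst_def map_concat sum_list_concat_map case_prod_unfold o_def mult.left_commute
      simp flip: sum_list_const_mult intro!: arg_cong[of _ _ sum_list] simp del: fact_Suc)

text \<open>The jet at u = 0 of u_i^k / k!.\<close>

definition run :: "nat \<Rightarrow> nat \<Rightarrow> nat list \<Rightarrow> real" where
  "run i k s = (if s = replicate k i then 1 else 0)"

lemma run_simps [simp]:
  "run i k [] = (if k = 0 then 1 else 0)"
  "run i 0 (j # s) = 0"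
  "run i (Suc k) (j # s) = (if j = i then run i k s else 0)"
  by (auto simp: run_def)

text \<open>Completing a block of \<open>i\<close> selects a subsequence consisting of copies of
  \<open>i\<close>, and the Leibniz product with \<open>run i k\<close> enumerates exactly these.
  More than \<open>length l\<close> copies cannot be selected, so any larger \<open>K\<close> gives
  the same sum. This turns list recursion into product algebra.\<close>

lemma ext_sum:
  assumes "length l \<le> K"
  shows "(\<Sum>(k, t)\<leftarrow>ext i l. \<psi> k t) = (\<Sum>k\<le>K. jmult (run i k) (\<psi> k) l)"
  using assms
proof (induction l arbitrary: K \<psi>)
  case Nil
  have "(\<Sum>k\<le>K. jmult (run i k) (\<psi> k) []) = (\<Sum>k\<le>K. if k = 0 then \<psi> 0 [] else 0)"
    by (intro sum.cong) auto
  then show ?case by simp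
next
  case (Cons j l)
  obtain K' where K: "K = Suc K'" "length l \<le> K'" using Cons.prems by (cases K) auto
  have 1: "(\<Sum>(k, t)\<leftarrow>ext i l. \<psi> k (j # t)) = (\<Sum>k\<le>K. jmult (run i k) (jdiff j (\<psi> k)) l)"
    using Cons.IH[of K "\<lambda>k t. \<psi> k (j # t)"] Cons.prems by simp
  have 2: "(if j = i then \<Sum>(k, t)\<leftarrow>ext i l. \<psi> (Suc k) t else 0) = (\<Sum>k\<le>K. jmult (jdiff j (run i k)) (\<psi> k) l)"
    using Cons.IH[OF K(2), of "\<lambda>k. \<psi> (Suc k)"] by (auto simp: K(1) sum.atMost_Suc_shift simp del: sum.atMost_Suc)
  show ?case using 1 2 by (auto simp: case_prod_unfold o_def sum.distrib)
qed

text \<open>Chain rule: the derivative of y_(k+1) in u_i is (k+1) u_i^k = (k+1)! times u_i^k /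
  k!.\<close>

lemma powsum_subst_jdiff:
  assumes "length l \<le> K" "i \<in> A"
  shows "powsum_subst A b (i # l) = (\<Sum>k\<le>K. jmult (run i k) (\<lambda>t. fact (Suc k) * powsum_subst A (jdiff (Suc k) b) t) l)"
  using ext_sum[OF assms(1), of "\<lambda>k t. fact (Suc k) * powsum_subst A (jdiff (Suc k) b) t" i] assms(2)
  by (simp add: powsum_subst_Cons)

lemma powsum_subst_add: "powsum_subst A (\<lambda>s. b s + c s) l = powsum_subst A b l + powsum_subst A c l"
  by (simp add: powsum_subst_def case_prod_unfold distrib_left sum_list_addf)

lemma powsum_subst_scale: "powsum_subst A (\<lambda>s. r * b s) l = r * powsum_subst A b l"
  by (simp add: powsum_subst_def case_prod_unfold sum_list_const_mult[symmetric] mult_ac)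

lemma powsum_subst_zero: "powsum_subst A (\<lambda>_. 0) l = 0"
  by (simp add: powsum_subst_def case_prod_unfold)

lemma powsum_subst_unit: "powsum_subst A unit_jet = unit_jet"
proof
  show "powsum_subst A unit_jet l = unit_jet l" for l
    by (cases l) (simp_all add: powsum_subst_Cons powsum_subst_zero case_prod_unfold)
qed

text \<open>After one chain-rule step the remaining factors are evaluated only on shorter lists,
  where the induction hypothesis turns the Leibniz rule in y into products of substituted
  jets.\<close>

lemma powsum_subst_jmult: "powsum_subst A (jmult b c) l = jmult (powsum_subst A b) (powsum_subst A c) l"
proof (induction "length l" arbitrary: l b c rule: less_induct)
  case less
  show ?case
  proof (cases l)
    case (Cons i t)
    show ?thesis
    proof (cases "i \<in> A")
      case True
      let ?K = "length t" and ?B = "powsum_subst A b" and ?C = "powsum_subst A c"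
      let ?D = "\<lambda>b k t. fact (Suc k) * powsum_subst A (jdiff (Suc k) b) t"
      have "powsum_subst A (jmult b c) l = (\<Sum>k\<le>?K. jmult (run i k) (\<lambda>t. fact (Suc k) *
          powsum_subst A (\<lambda>s. jmult (jdiff (Suc k) b) c s + jmult b (jdiff (Suc k) c) s) t) t)"
        using powsum_subst_jdiff[OF le_refl[of "length t"] True, of "jmult b c"] Cons by simp
      also have "\<dots> = (\<Sum>k\<le>?K. jmult (run i k) (\<lambda>t. jmult (?D b k) ?C t + jmult ?B (?D c k) t) t)"
      proof (intro sum.cong jmult_cong refl)
        fix k and s :: "nat list" assume "length s \<le> length t"
        then have "length s < length l" using Cons by simp
        from less.hyps[OF this]
        show "fact (Suc k) * powsum_subst A (\<lambda>s. jmult (jdiff (Suc k) b) c s + jmult b (jdiff (Suc k) c) s) s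
            = jmult (?D b k) ?C s + jmult ?B (?D c k) s"
          unfolding powsum_subst_add jmult_scale_left jmult_scale_right by (simp add: distrib_left)
      qed
      also have "\<dots> = jmult (\<lambda>s. \<Sum>k\<le>?K. jmult (run i k) (?D b k) s) ?C t
                   + jmult ?B (\<lambda>s. \<Sum>k\<le>?K. jmult (run i k) (?D c k) s) t"
        by (simp add: jmult_add_right sum.distrib jmult_sum_left jmult_sum_right jmult_ac del: fact_Suc)
      also have "jmult (\<lambda>s. \<Sum>k\<le>?K. jmult (run i k) (?D b k) s) ?C t = jmult (jdiff i ?B) ?C t"
        by (intro jmult_cong refl powsum_subst_jdiff[symmetric] True)
      also have "jmult ?B (\<lambda>s. \<Sum>k\<le>?K. jmult (run i k) (?D c k) s) t = jmult ?B (jdiff i ?C) t"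
        by (intro jmult_cong refl powsum_subst_jdiff[symmetric] True)
      finally show ?thesis using Cons by simp
    qed (simp add: Cons powsum_subst_Cons)
  qed simp
qed

lemma powsum_subst_jln:
  assumes nz: "f [] \<noteq> 0"
  shows "powsum_subst A (jln f) = jln (powsum_subst A f)"
proof (rule jln_unique)
  fix i l
  let ?F = "powsum_subst A f"
  show "jmult ?F (jdiff i (powsum_subst A (jln f))) l = powsum_subst A f (i # l)"
  proof (cases "i \<in> A")
    case True
    let ?K = "length l"
    let ?D = "\<lambda>b k t. fact (Suc k) * powsum_subst A (jdiff (Suc k) b) t"
    have "jmult ?F (jdiff i (powsum_subst A (jln f))) l = jmult ?F (\<lambda>s. \<Sum>k\<le>?K. jmult (run i k) (?D (jln f) k) s) l"
      by (intro jmult_cong refl powsum_subst_jdiff True)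
    also have "\<dots> = (\<Sum>k\<le>?K. jmult (run i k) (jmult ?F (?D (jln f) k)) l)"
      by (simp add: jmult_sum_right jmult_left_comm_fun del: fact_Suc jln.simps)
    also have "\<dots> = (\<Sum>k\<le>?K. jmult (run i k) (?D f k) l)"
    proof (intro sum.cong jmult_cong refl)
      fix k s
      have "jmult ?F (?D (jln f) k) s = fact (Suc k) * powsum_subst A (jmult f (jdiff (Suc k) (jln f))) s"
        by (simp add: jmult_scale_right powsum_subst_jmult del: fact_Suc jln.simps)
      then show "jmult ?F (?D (jln f) k) s = ?D f k s"
        unfolding jmult_jdiff_jln[of f, OF nz] .
    qed
    also have "\<dots> = powsum_subst A f (i # l)"
      by (intro powsum_subst_jdiff[symmetric] True order_refl)
    finally show ?thesis .
  qed (simp add: powsum_subst_Cons)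
qed (use nz in auto)

subsection \<open>Jets of monomials\<close>

fun mjet :: "(nat \<Rightarrow> nat list \<Rightarrow> real) \<Rightarrow> nat list \<Rightarrow> nat list \<Rightarrow> real" where
  "mjet q [] = unit_jet"
| "mjet q (n # m) = jmult (q n) (mjet q m)"

text \<open>Derivatives of \<open>p\<^sub>n\<close>, as a coordinate and as the power sum in \<open>N\<close> variables.\<close>

definition pjet :: "(nat \<Rightarrow> real) \<Rightarrow> nat \<Rightarrow> nat list \<Rightarrow> real" where
  "pjet p n s = (if s = [] then p n else if s = [n] then 1 else 0)"

text \<open>Mixed derivatives of a power sum vanish. For orders above \<open>n\<close> the binomial
  coefficient is 0, so the truncated exponent is harmless.\<close>

definition xjet :: "nat \<Rightarrow> (nat \<Rightarrow> real) \<Rightarrow> nat \<Rightarrow> nat list \<Rightarrow> real" where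
  "xjet N x n s = (if s = [] then \<Sum>i<N. x i ^ n
     else if hd s < N \<and> s = replicate (length s) (hd s)
     then fact (length s) * real (n choose length s) * x (hd s) ^ (n - length s) else 0)"

lemma mjet_pjet_Nil: "mjet (pjet p) m [] = pmono p m"
  by (induction m) (simp_all add: pjet_def pmono_def)

lemma mjet_xjet_Nil: "mjet (xjet N x) m [] = pmono (\<lambda>n. \<Sum>i<N. x i ^ n) m"
  by (induction m) (simp_all add: xjet_def pmono_def)

lemma jet_on_mjet:
  assumes "\<And>n. jet_on U (\<lambda>p. q p n)"
  shows "jet_on U (\<lambda>p. mjet (q p) m)"
proof (induction m)
  case Nil
  show ?case by (auto simp: jet_on_def)
next
  case (Cons n m)
  show ?case using jet_on_jmult[OF assms Cons] by simp
qed

lemma jet_on_pjet: "jet_on U (\<lambda>p. pjet p n)"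
  unfolding jet_on_def
proof (intro ballI allI)
  fix p :: "nat \<Rightarrow> real" and i :: nat and l :: "nat list"
  show "((\<lambda>t. pjet (p(i := t)) n l) has_field_derivative pjet p n (i # l)) (at (p i))"
    by (cases "l = []"; cases "i = n") (auto simp: pjet_def)
qed

lemma jet_on_xjet: "jet_on U (\<lambda>x. xjet N x n)"
  unfolding jet_on_def
proof (intro ballI allI)
  fix x :: "nat \<Rightarrow> real" and i :: nat and l :: "nat list"
  show "((\<lambda>t. xjet N (x(i := t)) n l) has_field_derivative xjet N x n (i # l)) (at (x i))"
  proof (cases l)
    case Nil
    have "((\<lambda>t. \<Sum>j<N. (x(i := t)) j ^ n) has_field_derivative
        (\<Sum>j<N. if j = i then real n * x i ^ (n - 1) else 0)) (at (x i))"
      by (intro DERIV_sum) (auto intro!: derivative_eq_intros)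
    then show ?thesis unfolding Nil by (cases "i < N") (simp_all add: xjet_def)
  next
    case (Cons j l')
    let ?k = "length l"
    show ?thesis
    proof (cases "j = i \<and> i < N \<and> l = replicate ?k j")
      case True
      then have h: "replicate ?k i = l" "hd l = i" "l \<noteq> []" "i < N"
        using Cons by auto
      have "fact ?k * real (n choose ?k) * real (n - ?k) = fact (Suc ?k) * real (n choose Suc ?k)"
      proof -
        have "(n choose ?k) * (n - ?k) = Suc ?k * (n choose Suc ?k)"
          using binomial_absorb_comp[of n ?k] binomial_absorption[of ?k n] by (simp add: mult.commute)
        then have "real (n choose ?k) * real (n - ?k) = real (Suc ?k) * real (n choose Suc ?k)"
          unfolding of_nat_mult[symmetric] by (rule arg_cong)
        then show ?thesis by (simp add: mult_ac del: of_nat_Suc)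
      qed
      moreover have "((\<lambda>t. fact ?k * real (n choose ?k) * t ^ (n - ?k)) has_field_derivative
          fact ?k * real (n choose ?k) * (real (n - ?k) * x i ^ (n - Suc ?k))) (at (x i))"
        by (auto intro!: derivative_eq_intros)
      moreover have "xjet N (x(i := t)) n l = fact ?k * real (n choose ?k) * t ^ (n - ?k)" for t
        using h by (simp add: xjet_def del: fact_Suc)
      moreover have "xjet N x n (i # l) = fact (Suc ?k) * real (n choose Suc ?k) * x i ^ (n - Suc ?k)"
        using h by (simp add: xjet_def del: fact_Suc)
      ultimately show ?thesis by (simp add: mult.assoc[symmetric] del: fact_Suc of_nat_Suc)
    next
      case False
      then have "xjet N x n (i # l) = 0" using Cons by (auto simp: xjet_def)
      moreover have "xjet N (x(i := t)) n l = xjet N x n l" for t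
        using False Cons by (auto simp: xjet_def)
      ultimately show ?thesis by simp
    qed
  qed
qed

section \<open>Bounds for the derivatives of monomials\<close>

lemma mjet_bound:
  assumes "\<And>n s. n \<in> set m \<Longrightarrow> \<bar>q n s\<bar> \<le> A n * prod_list (map (\<beta> n) s)"
  shows "\<bar>mjet q m s\<bar> \<le> prod_list (map A m) * prod_list (map (\<lambda>i. \<Sum>n\<leftarrow>m. \<beta> n i) s)"
  using assms
proof (induction m arbitrary: s)
  case Nil
  then show ?case by (cases s) auto
next
  case (Cons n m)
  have "\<bar>jmult (q n) (mjet q m) s\<bar> \<le> A n * prod_list (map A m)
      * prod_list (map (\<lambda>i. \<beta> n i + (\<Sum>n\<leftarrow>m. \<beta> n i)) s)"
    by (rule jmult_bound) (use Cons in auto)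
  then show ?case by simp
qed

lemma prod_list_scaled_power:
  "prod_list (map (\<lambda>n. c * R ^ n) m) = c ^ length m * (R::real) ^ sum_list m"
  by (induction m) (simp_all add: power_add mult_ac)

lemma prod_list_const: "prod_list (map (\<lambda>_. c) s) = (c::real) ^ length s"
  by (induction s) simp_all

text \<open>The derivative 1 of p_n in its own direction is written as R^n R^(-n). This trade is the
  source of the geometric decay; its price is the factor R^|m|.\<close>

lemma mjet_pjet_bound:
  fixes N R :: real
  assumes "1 \<le> N" "1 \<le> R" "\<And>n. n \<in> set m \<Longrightarrow> \<bar>p n\<bar> \<le> N * R ^ n"
  shows "\<bar>mjet (pjet p) m s\<bar> \<le>
     N ^ length m * R ^ sum_list m * real (length m) ^ length s * (1 / R) ^ sum_list s"
proof -
  have "\<bar>mjet (pjet p) m s\<bar> \<le> prod_list (map (\<lambda>n. N * R ^ n) m)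
      * prod_list (map (\<lambda>i. \<Sum>n\<leftarrow>m. (1 / R) ^ i) s)"
  proof (rule mjet_bound)
    fix n and s :: "nat list" assume n: "n \<in> set m"
    show "\<bar>pjet p n s\<bar> \<le> N * R ^ n * prod_list (map (\<lambda>i. (1 / R) ^ i) s)"
      unfolding prod_list_power using assms n by (auto simp: pjet_def power_divide)
  qed
  also have "(\<lambda>i. \<Sum>n\<leftarrow>m. (1 / R) ^ i) = (\<lambda>i. real (length m) * (1 / R) ^ i)"
    by (simp add: sum_list_triv)
  finally show ?thesis unfolding prod_list_scaled_power by (simp add: mult_ac)
qed

text \<open>A derivative of order k of x^n costs k! binom(n,k) \<le> n^k. Over all parts of
  \<open>m\<close> this adds up to a factor |m| per derivative.\<close>

lemma mjet_xjet_bound: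
  assumes "1 \<le> R" "\<And>i. i < N \<Longrightarrow> \<bar>x i\<bar> \<le> R"
  shows "\<bar>mjet (xjet N x) m s\<bar> \<le> real N ^ length m * R ^ sum_list m * real (sum_list m) ^ length s"
proof -
  have "\<bar>mjet (xjet N x) m s\<bar> \<le> prod_list (map (\<lambda>n. real N * R ^ n) m)
      * prod_list (map (\<lambda>i. \<Sum>n\<leftarrow>m. real n) s)"
  proof (rule mjet_bound)
    fix n and s :: "nat list"
    have pow: "\<bar>x i\<bar> ^ k \<le> R ^ n" if "i < N" "k \<le> n" for i k
      using power_mono[OF assms(2)[OF that(1)], of k] power_increasing[OF that(2) assms(1)] by simp
    consider "s = []" | "s \<noteq> []" "hd s < N" "s = replicate (length s) (hd s)"
      | "xjet N x n s = 0" unfolding xjet_def by metis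
    then show "\<bar>xjet N x n s\<bar> \<le> real N * R ^ n * prod_list (map (\<lambda>i. real n) s)"
    proof cases
      case 1
      have "\<bar>\<Sum>i<N. x i ^ n\<bar> \<le> (\<Sum>i<N. R ^ n)"
        by (rule order_trans[OF sum_abs sum_mono]) (use pow in \<open>auto simp: power_abs\<close>)
      then show ?thesis using 1 by (simp add: xjet_def)
    next
      case 2
      let ?k = "length s"
      have "real (fact ?k * (n choose ?k)) \<le> real (n ^ ?k)"
        unfolding of_nat_le_iff using binomial_fact_pow[of n ?k] by (simp add: mult.commute)
      then have "fact ?k * real (n choose ?k) \<le> real n ^ ?k" by simp
      then have "\<bar>xjet N x n s\<bar> \<le> real n ^ ?k * R ^ n"
        using 2 pow[of "hd s" "n - ?k"]
        by (auto simp: xjet_def abs_mult power_abs intro!: mult_mono)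
      also have "\<dots> \<le> real n ^ ?k * (real N * R ^ n)"
        using 2 assms by (intro mult_left_mono) (auto simp: mult_le_cancel_right1)
      finally show ?thesis unfolding prod_list_const by (simp add: mult_ac)
    next
      case 3
      then show ?thesis unfolding prod_list_const using assms by simp
    qed
  qed
  then show ?thesis unfolding prod_list_scaled_power prod_list_const
    by (simp flip: sum_list_of_nat)
qed

context
  fixes \<rho> :: real
  assumes \<rho>: "0 < \<rho>" "\<rho> < 1"
begin

lemma geom_pjet: "geom \<rho> k (pjet p n)"
  unfolding geom_def
proof (intro exI[of _ "\<bar>p n\<bar> + 1 / \<rho> ^ n"] allI impI)
  fix s :: "nat list"
  show "\<bar>pjet p n s\<bar> \<le> (\<bar>p n\<bar> + 1 / \<rho> ^ n) * \<rho> ^ sum_list s"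
    using \<rho> by (auto simp: pjet_def distrib_right)
qed

lemma geom_unit: "geom \<rho> k unit_jet"
  unfolding geom_def unit_jet_def using \<rho> by (intro exI[of _ 1]) auto

lemma geom_mjet_pjet: "geom \<rho> k (mjet (pjet p) m)"
  using \<rho> by (induction m) (auto simp: geom_unit intro!: geom_jmult geom_pjet)

end

section \<open>Both substitutions on monomials\<close>

lemma bdiff_pjet: "bdiff k (pjet p n) = (\<lambda>s. real (n choose k) * unit_jet s)"
proof
  fix s
  have "bdiff k (pjet p n) s = (\<Sum>\<^sub>\<infinity>i\<in>{n}. real (i choose k) * pjet p n (i # s))"
    unfolding bdiff_def by (rule infsum_cong_neutral) (auto simp: pjet_def)
  then show "bdiff k (pjet p n) s = real (n choose k) * unit_jet s"
    by (auto simp: pjet_def unit_jet_def)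
qed

lemma bdiff_zero [simp]: "bdiff k (\<lambda>_. 0) = (\<lambda>_. 0)"
  by (rule ext) (simp add: bdiff_def)

lemma bdiff_scaled_unit [simp]: "bdiff k (\<lambda>s. r * unit_jet s) = (\<lambda>_. 0)"
  by (rule ext) (simp add: bdiff_def)

lemma binom_subst_zero: "binom_subst (\<lambda>_. 0) ks = 0"
  by (induction ks) simp_all

lemma binom_subst_scaled_unit: "binom_subst (\<lambda>s. r * unit_jet s) ks = r * unit_jet ks"
  by (cases ks) (simp_all add: binom_subst_zero)

lemma binom_subst_pjet_Cons: "binom_subst (pjet p n) (k # ks) = real (n choose k) * unit_jet ks"
  by (simp add: bdiff_pjet binom_subst_scaled_unit)

lemma binom_subst_unit: "binom_subst unit_jet = unit_jet"
  using binom_subst_scaled_unit[of 1] by auto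

lemma binom_subst_mjet: "binom_subst (mjet (pjet p) m) = mjet (\<lambda>n. binom_subst (pjet p n)) m"
proof (induction m)
  case (Cons n m)
  have "binom_subst (jmult (pjet p n) (mjet (pjet p) m)) ks = jmult (binom_subst (pjet p n)) (binom_subst (mjet (pjet p) m)) ks" for ks
    \<comment> \<open>Any rate in (0,1) would do, as a monomial has only finitely many nonzero
      derivatives.\<close>
    by (rule binom_subst_jmult[of "1/2"]) (auto intro: geom_pjet geom_mjet_pjet)
  then show ?case using Cons by auto
qed (simp add: binom_subst_unit)

lemma powsum_subst_mjet: "powsum_subst A (mjet q m) = mjet (\<lambda>n. powsum_subst A (q n)) m"
proof (induction m)
  case (Cons n m)
  then show ?case using powsum_subst_jmult[of A "q n" "mjet q m"] by auto
qed (simp add: powsum_subst_unit)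

text \<open>The binomial theorem for \<Sum> (1 + u_i)^n, read off on Taylor coefficients.\<close>

lemma powsum_subst_binom_subst_pjet:
  "powsum_subst {..<N} (binom_subst (pjet (\<lambda>_. real N) n)) = xjet N (\<lambda>_. 1) n"
proof
  fix l
  show "powsum_subst {..<N} (binom_subst (pjet (\<lambda>_. real N) n)) l = xjet N (\<lambda>_. 1) n l"
  proof (cases l)
    case (Cons i t)
    show ?thesis
    proof (cases "i < N")
      case True
      let ?b = "binom_subst (pjet (\<lambda>_. real N) n)"
      have dlb: "jdiff (Suc k) ?b = (\<lambda>s. real (n choose Suc k) * unit_jet s)" for k
        by (simp add: binom_subst_pjet_Cons del: binom_subst.simps)
      have "powsum_subst {..<N} ?b l
          = (\<Sum>k\<le>length t. fact (Suc k) * real (n choose Suc k) * run i k t)"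
        using powsum_subst_jdiff[OF le_refl[of "length t"], of i "{..<N}" ?b] True Cons
        unfolding dlb powsum_subst_scale powsum_subst_unit jmult_scale_right by (simp add: mult_ac del: fact_Suc)
      also have "\<dots> = (\<Sum>k\<le>length t. if k = length t then fact (Suc k) * real (n choose Suc k) * run i k t else 0)"
        by (intro sum.cong) (auto simp: run_def)
      finally show ?thesis using True Cons by (simp add: run_def xjet_def del: fact_Suc)
    qed (simp add: Cons powsum_subst_Cons xjet_def)
  qed (simp add: xjet_def pjet_def)
qed

lemma powsum_subst_binom_subst_mjet:
  "powsum_subst {..<N} (binom_subst (mjet (pjet (\<lambda>_. real N)) m)) = mjet (xjet N (\<lambda>_. 1)) m"
  by (simp add: binom_subst_mjet powsum_subst_mjet powsum_subst_binom_subst_pjet)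

subsection \<open>Derivatives of the generating function\<close>

lemma jet_on_infsum:
  assumes U: "copen U" and u: "\<And>m. m \<in> I \<Longrightarrow> jet_on U (u m)"
    and bound: "\<And>m p s. m \<in> I \<Longrightarrow> p \<in> U \<Longrightarrow> \<bar>u m p s\<bar> \<le> \<beta> s m"
    and summable: "\<And>s. \<beta> s summable_on I"
  shows "jet_on U (\<lambda>p s. \<Sum>\<^sub>\<infinity>m\<in>I. u m p s)"
  unfolding jet_on_def
proof (intro ballI allI)
  fix p i l assume p: "p \<in> U"
  have ev: "\<forall>\<^sub>F t in nhds (p i). p(i := t) \<in> U" using U p unfolding copen_def by blast
  have "((\<lambda>t. \<Sum>\<^sub>\<infinity>m\<in>I. u m (p(i := t)) l) has_field_derivative
      (\<Sum>\<^sub>\<infinity>m\<in>I. u m (p(i := p i)) (i # l))) (at (p i))"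
  proof (rule infsum_deriv[OF _ _ summable])
    show "\<forall>\<^sub>F t in nhds (p i). \<forall>m\<in>I.
        ((\<lambda>t. u m (p(i := t)) l) has_field_derivative u m (p(i := t)) (i # l)) (at t) \<and>
        \<bar>u m (p(i := t)) (i # l)\<bar> \<le> \<beta> (i # l) m"
      using ev
    proof eventually_elim
      case (elim t)
      show ?case using jet_onD[OF u elim, of _ i l] bound[OF _ elim] by auto
    qed
    show "\<forall>\<^sub>F t in nhds (p i). (\<lambda>m. u m (p(i := t)) l) summable_on I"
      using ev by eventually_elim (rule summable_on_dominated[OF summable], rule bound)
  qed
  then show "((\<lambda>t. \<Sum>\<^sub>\<infinity>m\<in>I. u m (p(i := t)) l) has_field_derivative
      (\<Sum>\<^sub>\<infinity>m\<in>I. u m p (i # l))) (at (p i))" by simp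
qed

text \<open>\<open>deriv\<close> is informative only where a derivative exists, which the jet
  supplies. Openness along coordinates provides the induction hypothesis at all nearby points of the
  line being differentiated.\<close>

lemma pdiff_eq_jet:
  assumes U: "copen U" and b: "jet_on U b" and \<Phi>: "\<And>p. p \<in> U \<Longrightarrow> \<Phi> p = b p []"
    and p: "p \<in> U"
  shows "pdiff is \<Phi> p = b p is"
  using p
proof (induction "is" arbitrary: p)
  case (Cons i "is")
  have "\<forall>\<^sub>F t in nhds (p i). p(i := t) \<in> U" using U Cons.prems unfolding copen_def by blast
  then have "\<forall>\<^sub>F t in nhds (p i). pdiff is \<Phi> (p(i := t)) = b (p(i := t)) is"
    by eventually_elim (rule Cons.IH)
  then have "deriv (\<lambda>t. pdiff is \<Phi> (p(i := t))) (p i) = deriv (\<lambda>t. b (p(i := t)) is) (p i)"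
    by (rule deriv_cong_ev) simp
  also have "\<dots> = b p (i # is)"
    by (rule DERIV_imp_deriv[OF jet_onD[OF b Cons.prems]])
  finally show ?case by simp
qed (simp add: \<Phi>)

lemma pdiff_const: "is \<noteq> [] \<Longrightarrow> pdiff is (\<lambda>_. c) = (\<lambda>_. 0)"
proof (induction "is")
  case (Cons i "is")
  then show ?case by (cases "is = []") auto
qed simp

lemma pdiff_ln_eq_jln:
  assumes U: "copen U" and b: "jet_on U b" and \<Phi>: "\<And>p. p \<in> U \<Longrightarrow> \<Phi> p = b p []"
    and p: "p \<in> U" "\<Phi> p > 0"
  shows "pdiff is (\<lambda>p. ln (\<Phi> p)) p = jln (b p) is"
proof (rule pdiff_eq_jet[where U = "{p \<in> U. b p [] > 0}"])
  have "isCont (\<lambda>t. b (p(i := t)) []) (p i)" if "p \<in> U" for p i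
    by (rule DERIV_isCont[OF jet_onD[OF b that]])
  then show "copen {p \<in> U. b p [] > 0}" by (rule copen_continuous[OF U])
  show "jet_on {p \<in> U. b p [] > 0} (\<lambda>p. jln (b p))"
    using b by (intro jet_on_jln) (auto simp: jet_on_def)
qed (use \<Phi> p in auto)

lemma partitions_length_le:
  assumes "m \<in> partitions"
  shows "length m \<le> sum_list m"
proof -
  have "0 \<notin> set m \<Longrightarrow> length m \<le> sum_list m" by (induction m) auto
  then show ?thesis using assms by (simp add: partitions_def)
qed

lemma has_sum_sum_list:
  fixes f :: "'b \<Rightarrow> 'a \<Rightarrow> real"
  assumes "\<And>x. x \<in> set xs \<Longrightarrow> (f x has_sum g x) I"
  shows "((\<lambda>m. \<Sum>x\<leftarrow>xs. f x m) has_sum (\<Sum>x\<leftarrow>xs. g x)) I"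
  using assms by (induction xs) (auto intro!: has_sum_add)

lemma bdiff_scale: "bdiff k (\<lambda>s. r * f s) = (\<lambda>s. r * bdiff k f s)"
proof
  fix s
  have "bdiff k (\<lambda>s. r * f s) s = (\<Sum>\<^sub>\<infinity>i. r * (real (i choose k) * f (i # s)))"
    unfolding bdiff_def by (simp add: mult_ac)
  then show "bdiff k (\<lambda>s. r * f s) s = r * bdiff k f s" by (simp add: bdiff_def infsum_cmult_right')
qed

lemma binom_subst_scale: "binom_subst (\<lambda>s. r * f s) ks = r * binom_subst f ks"
  by (induction ks arbitrary: f) (simp_all add: bdiff_scale)

lemma terms_pos: "(w, ks) \<in> set (terms A js) \<Longrightarrow> \<forall>k\<in>set ks. 1 \<le> k"
proof (induction "length js" arbitrary: js w ks rule: less_induct)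
  case less
  show ?case
  proof (cases js)
    case (Cons i l)
    then obtain k t w' ks' where *: "(k, t) \<in> set (ext i l)" "(w', ks') \<in> set (terms A t)"
      "ks = Suc k # ks'" using less.prems by (auto split: if_splits)
    then show ?thesis using less.hyps[OF _ *(2)] ext_length[OF *(1)] Cons by auto
  qed (use less in auto)
qed

lemma terms_nonempty: "(w, ks) \<in> set (terms A js) \<Longrightarrow> js \<noteq> [] \<Longrightarrow> ks \<noteq> []"
  by (cases js) (auto split: if_splits)

lemma copen_weighted_box:
  "copen {p. \<forall>n. n \<in> J \<longrightarrow> \<bar>p n\<bar> < r n}"
  unfolding copen_def
proof (intro ballI allI)
  fix p i assume p: "p \<in> {p. \<forall>n. n \<in> J \<longrightarrow> \<bar>p n\<bar> < r n}"
  show "\<forall>\<^sub>F t in nhds (p i). p(i := t) \<in> {p. \<forall>n. n \<in> J \<longrightarrow> \<bar>p n\<bar> < r n}"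
  proof (cases "i \<in> J")
    case True
    have "open {t::real. \<bar>t\<bar> < r i}" by (intro open_Collect_less continuous_intros)
    then have "\<forall>\<^sub>F t in nhds (p i). t \<in> {t. \<bar>t\<bar> < r i}"
      by (rule eventually_nhds_in_open) (use p True in auto)
    then show ?thesis by eventually_elim (use p in auto)
  qed (use p in auto)
qed

section \<open>Series of monomials with radius R > 1\<close>

context
  fixes a :: "nat list \<Rightarrow> real" and N :: nat and R :: real
  assumes N: "1 \<le> N" and R: "1 < R"
    and a: "\<And>n. (\<lambda>m. \<bar>a m\<bar> * real N ^ length m * R ^ sum_list m * real (Suc (sum_list m)) ^ n)
        summable_on partitions"
begin

lemma weighted_power_le:
  assumes "x \<le> real (Suc (sum_list m))" "0 \<le> x"
  shows "\<bar>a m\<bar> * (real N ^ length m * R ^ sum_list m * x ^ length s)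
    \<le> \<bar>a m\<bar> * real N ^ length m * R ^ sum_list m * real (Suc (sum_list m)) ^ length s"
  unfolding mult.assoc
  by (intro mult_left_mono power_mono mult_nonneg_nonneg) (use assms R in auto)

text \<open>Each derivative costs a factor \<open>length m\<close>, at most the degree because parts
  are positive; this is why the summability condition carries a polynomial weight.\<close>

lemma pjet_term_bound:
  assumes "m \<in> partitions" "\<And>n. 1 \<le> n \<Longrightarrow> \<bar>p n\<bar> \<le> N * R ^ n"
  shows "\<bar>a m * mjet (pjet p) m s\<bar> \<le> \<bar>a m\<bar> * real N ^ length m * R ^ sum_list m
      * real (Suc (sum_list m)) ^ length s * (1 / R) ^ sum_list s"
proof -
  have pos: "1 \<le> n" if "n \<in> set m" for n
    using that assms(1) by (cases "n = 0") (auto simp: partitions_def)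
  have "\<bar>mjet (pjet p) m s\<bar> \<le> real N ^ length m * R ^ sum_list m
      * real (length m) ^ length s * (1 / R) ^ sum_list s"
    by (rule mjet_pjet_bound) (use N R in \<open>auto intro!: assms(2) pos\<close>)
  then have "\<bar>a m * mjet (pjet p) m s\<bar> \<le> \<bar>a m\<bar> * (real N ^ length m * R ^ sum_list m
      * real (length m) ^ length s) * (1 / R) ^ sum_list s"
    unfolding abs_mult by (metis abs_ge_zero mult.assoc mult_left_mono)
  also have "\<dots> \<le> (\<bar>a m\<bar> * real N ^ length m * R ^ sum_list m
      * real (Suc (sum_list m)) ^ length s) * (1 / R) ^ sum_list s"
    by (intro mult_right_mono weighted_power_le)
       (use R partitions_length_le[OF assms(1)] in auto)
  finally show ?thesis .
qed

lemma xjet_term_bound: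
  assumes "m \<in> partitions" "\<And>i. i < N \<Longrightarrow> \<bar>x i\<bar> \<le> R"
  shows "\<bar>a m * mjet (xjet N x) m s\<bar> \<le> \<bar>a m\<bar> * real N ^ length m * R ^ sum_list m
      * real (Suc (sum_list m)) ^ length s"
proof -
  have "\<bar>mjet (xjet N x) m s\<bar> \<le> real N ^ length m * R ^ sum_list m * real (sum_list m) ^ length s"
    by (rule mjet_xjet_bound) (use R assms(2) in auto)
  then have "\<bar>a m * mjet (xjet N x) m s\<bar> \<le> \<bar>a m\<bar> * (real N ^ length m * R ^ sum_list m
      * real (sum_list m) ^ length s)"
    unfolding abs_mult by (intro mult_left_mono) auto
  also have "\<dots> \<le> \<bar>a m\<bar> * real N ^ length m * R ^ sum_list m
      * real (Suc (sum_list m)) ^ length s"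
    by (intro weighted_power_le) auto
  finally show ?thesis .
qed

definition fjet :: "(nat \<Rightarrow> real) \<Rightarrow> nat list \<Rightarrow> real" where
  "fjet p s = (\<Sum>\<^sub>\<infinity>m\<in>partitions. a m * mjet (pjet p) m s)"

definition fxjet :: "(nat \<Rightarrow> real) \<Rightarrow> nat list \<Rightarrow> real" where
  "fxjet x s = (\<Sum>\<^sub>\<infinity>m\<in>partitions. a m * mjet (xjet N x) m s)"

lemma jet_on_scale: "jet_on U b \<Longrightarrow> jet_on U (\<lambda>p s. r * b p s)"
  unfolding jet_on_def by (auto intro: DERIV_cmult)

text \<open>For n \<ge> 1 the point 1^N satisfies N < N R^n. For n = 0 it would not, so that
  coordinate is left free; it does not occur in F_N, since partitions have no part 0.\<close>

lemma jet_on_fjet: "jet_on {p. \<forall>n. n \<in> {1..} \<longrightarrow> \<bar>p n\<bar> < real N * R ^ n} fjet"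
proof -
  have "jet_on {p. \<forall>n. n \<in> {1..} \<longrightarrow> \<bar>p n\<bar> < real N * R ^ n}
      (\<lambda>p s. \<Sum>\<^sub>\<infinity>m\<in>partitions. a m * mjet (pjet p) m s)"
    by (rule jet_on_infsum[OF copen_weighted_box jet_on_scale[OF jet_on_mjet[OF jet_on_pjet]] pjet_term_bound])
       (auto intro: less_imp_le intro!: a summable_on_cmult_left simp del: of_nat_Suc)
  then show ?thesis by (simp add: fjet_def[abs_def])
qed

lemma jet_on_fxjet: "jet_on {x. \<forall>i. i \<in> {..<N} \<longrightarrow> \<bar>x i\<bar> < R} fxjet"
proof -
  have "jet_on {x. \<forall>i. i \<in> {..<N} \<longrightarrow> \<bar>x i\<bar> < R}
      (\<lambda>p s. \<Sum>\<^sub>\<infinity>m\<in>partitions. a m * mjet (xjet N p) m s)"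
    by (rule jet_on_infsum[OF copen_weighted_box jet_on_scale[OF jet_on_mjet[OF jet_on_xjet]] xjet_term_bound])
       (auto intro: less_imp_le intro!: a simp del: of_nat_Suc)
  then show ?thesis by (simp add: fxjet_def[abs_def])
qed

lemma geom_family_fjet: "geom_family partitions (1 / R) (\<lambda>m s. a m * mjet (pjet (\<lambda>_. real N)) m s)"
  unfolding geom_family_def
proof
  fix n
  let ?\<alpha> = "\<lambda>m. \<bar>a m\<bar> * real N ^ length m * R ^ sum_list m * real (Suc (sum_list m)) ^ n"
  have "\<bar>a m * mjet (pjet (\<lambda>_. real N)) m s\<bar> \<le> ?\<alpha> m * (1 / R) ^ sum_list s"
    if m: "m \<in> partitions" and s: "length s \<le> n" for m s
  proof -
    have "\<bar>a m * mjet (pjet (\<lambda>_. real N)) m s\<bar> \<le> \<bar>a m\<bar> * real N ^ length m * R ^ sum_list m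
      * real (Suc (sum_list m)) ^ length s * (1 / R) ^ sum_list s"
      by (rule pjet_term_bound[OF m]) (use R in \<open>auto simp: mult_le_cancel_left1\<close>)
    also have "\<dots> \<le> ?\<alpha> m * (1 / R) ^ sum_list s"
      \<comment> \<open>The base is a successor, hence at least 1, so the weight grows with its
        exponent.\<close>
      by (intro mult_right_mono mult_left_mono power_increasing s) (use R in auto)
    finally show ?thesis .
  qed
  then show "\<exists>\<alpha>. \<alpha> summable_on partitions \<and> (\<forall>m\<in>partitions. \<forall>s. length s \<le> n \<longrightarrow>
      \<bar>a m * mjet (pjet (\<lambda>_. real N)) m s\<bar> \<le> \<alpha> m * (1 / R) ^ sum_list s)"
    using a[of n] by blast
qed

lemma fxjet_eq: "fxjet (\<lambda>_. 1) = powsum_subst {..<N} (binom_subst (fjet (\<lambda>_. real N)))"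
proof
  fix l
  let ?u = "\<lambda>m s. a m * mjet (pjet (\<lambda>_. real N)) m s"
  have \<rho>: "0 < 1 / R" "1 / R < 1" using R by auto
  have "((\<lambda>m. powsum_subst {..<N} (binom_subst (?u m)) l) has_sum powsum_subst {..<N} (binom_subst (fjet (\<lambda>_. real N))) l) partitions"
    unfolding powsum_subst_def fjet_def[abs_def] case_prod_unfold
    by (intro has_sum_sum_list has_sum_cmult_right binom_subst_infsum[OF \<rho>] geom_family_fjet)
  moreover have "powsum_subst {..<N} (binom_subst (?u m)) l = a m * mjet (xjet N (\<lambda>_. 1)) m l" for m
    unfolding binom_subst_scale powsum_subst_scale powsum_subst_binom_subst_mjet ..
  ultimately show "fxjet (\<lambda>_. 1) l = powsum_subst {..<N} (binom_subst (fjet (\<lambda>_. real N))) l"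
    unfolding fxjet_def by (simp add: infsumI)
qed

lemma pdiff_expansion:
  assumes F: "F = (\<lambda>p. \<Sum>\<^sub>\<infinity>m\<in>partitions. a m * pmono p m)" and pos: "F (\<lambda>_. real N) > 0"
    and js: "js \<noteq> []"
  shows "pdiff js (\<lambda>x. ln (F (\<lambda>n. \<Sum>i<N. x i ^ n))) (\<lambda>_. 1)
    = (\<Sum>(w, ks)\<leftarrow>terms {..<N} js. w * (\<Sum>\<^sub>\<infinity>is\<in>tuples (length ks).
        (\<Prod>j<length ks. real (is ! j choose ks ! j)) * pdiff is (\<lambda>p. ln (F p)) (\<lambda>_. real N)))"
proof -
  let ?f = "fjet (\<lambda>_. real N)"
  have \<rho>: "0 < 1 / R" "1 / R < 1" using R by auto
  have f_geom: "geom (1 / R) n ?f" for n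
    using geom_family_geom[OF \<rho> geom_family_fjet, of n] by (simp add: fjet_def[abs_def])
  have Fp: "F p = fjet p []" for p by (simp add: F fjet_def mjet_pjet_Nil)
  have f_nz: "?f [] \<noteq> 0" using pos Fp by auto
  have pd: "pdiff is (\<lambda>p. ln (F p)) (\<lambda>_. real N) = jln ?f is" for "is"
    by (rule pdiff_ln_eq_jln[OF copen_weighted_box jet_on_fjet Fp])
       (use N R pos in \<open>auto simp: mult_less_cancel_left1 intro!: one_less_power\<close>)
  have D: "(\<Sum>\<^sub>\<infinity>is\<in>tuples (length ks). (\<Prod>j<length ks. real (is ! j choose ks ! j))
      * pdiff is (\<lambda>p. ln (F p)) (\<lambda>_. real N)) = binom_subst (jln ?f) ks" if "\<forall>k\<in>set ks. 1 \<le> k" for ks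
    unfolding pd by (intro infsumI binom_subst_has_sum[OF \<rho>] geom_jln f_geom that) (use R in auto)
  have "pdiff js (\<lambda>x. ln (F (\<lambda>n. \<Sum>i<N. x i ^ n))) (\<lambda>_. 1) = jln (fxjet (\<lambda>_. 1)) js"
    by (rule pdiff_ln_eq_jln[OF copen_weighted_box jet_on_fxjet])
       (use R pos in \<open>auto simp: F fxjet_def mjet_xjet_Nil\<close>)
  also have "\<dots> = powsum_subst {..<N} (binom_subst (jln ?f)) js"
    unfolding fxjet_eq binom_subst_jln[of "1 / R", OF \<rho> f_geom f_nz]
    by (subst powsum_subst_jln) (use f_nz in auto)
  also have "\<dots> = (\<Sum>(w, ks)\<leftarrow>terms {..<N} js. w * (\<Sum>\<^sub>\<infinity>is\<in>tuples (length ks).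
        (\<Prod>j<length ks. real (is ! j choose ks ! j)) * pdiff is (\<lambda>p. ln (F p)) (\<lambda>_. real N)))"
    unfolding powsum_subst_def using D[OF terms_pos]
    by (intro arg_cong[of _ _ sum_list] map_cong refl) (auto simp only: split: prod.split)
  finally show ?thesis .
qed

end

section \<open>Positivity of F_N(1^N) and the identity for \<Psi>_N\<close>

lemma finite_ptn: "finite (ptn n)"
proof (rule finite_subset)
  show "ptn n \<subseteq> {l. set l \<subseteq> {..n} \<and> length l \<le> n}"
    using partitions_length_le by (auto simp: ptn_def intro: member_le_sum_list)
  show "finite {l. set l \<subseteq> {..n} \<and> length l \<le> n}"
    by (rule finite_lists_length_le) simp
qed

text \<open>The degree \<open>n\<close> part of \<open>F\<^sub>N\<close> at \<open>1\<^sup>N\<close> is a sum of the probabilities of those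
  \<open>l\<close> with \<open>J\<^sub>l(1\<^sup>N) \<noteq> 0\<close>; since \<open>x / 0 = 0\<close>, all other \<open>l\<close> do not contribute to \<open>F\<^sub>N\<close> at all.
  Hence no knowledge of Jack functions is needed for the positivity of \<open>F\<^sub>N(1\<^sup>N)\<close>.\<close>
lemma FN_pos_or_zero:
  assumes "(\<lambda>m. \<bar>acoef \<theta> M N m\<bar> * real N ^ length m) summable_on partitions"
  shows "FN \<theta> M N (\<lambda>_. real N) > 0 \<or> (\<forall>m\<in>partitions. acoef \<theta> M N m = 0)"
proof (subst disj_commute, rule disjCI)
  let ?F = "FN \<theta> M N (\<lambda>_. real N)" and ?e = "\<lambda>l. jack_eval \<theta> l (\<lambda>_. real N)"
  let ?b = "\<lambda>m. acoef \<theta> M N m * pmono (\<lambda>_. real N) m"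
  define S where "S n = (\<Sum>m\<in>ptn n. ?b m)" for n
  assume "\<not> ?F > 0"
  have pmono: "pmono (\<lambda>_. real N) m = real N ^ length m" for m
    by (simp add: pmono_def prod_list_const)
  have "?b summable_on partitions"
    by (rule summable_on_dominated[OF assms]) (simp add: pmono abs_mult)
  then have F: "(?b has_sum ?F) partitions" unfolding FN_def by (rule has_sum_infsum)
  have bij: "bij_betw snd (Sigma UNIV ptn) partitions"
    by (rule bij_betw_byWitness[where f' = "\<lambda>m. (sum_list m, m)"]) (auto simp: ptn_def)
  have "((\<lambda>z. ?b (snd z)) has_sum ?F) (Sigma UNIV ptn)"
    using has_sum_reindex_bij_betw[OF bij, of ?b ?F] F by simp
  then have S_sum: "(S has_sum ?F) UNIV"
    by (rule has_sum_Sigma') (auto simp: S_def intro!: has_sum_finite finite_ptn)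
  have S: "S n = (\<Sum>l\<in>Yd N \<inter> ptn n. pmf (M N) l * ?e l / ?e l)" for n
  proof -
    have "S n = (\<Sum>m\<in>ptn n. \<Sum>l\<in>Yd N \<inter> ptn n.
        pmf (M N) l / ?e l * (jack \<theta> l m * pmono (\<lambda>_. real N) m))"
      unfolding S_def acoef_def sum_distrib_right by (intro sum.cong) (auto simp: ptn_def)
    also have "\<dots> = (\<Sum>l\<in>Yd N \<inter> ptn n. pmf (M N) l / ?e l
        * (\<Sum>m\<in>ptn n. jack \<theta> l m * pmono (\<lambda>_. real N) m))"
      unfolding sum_distrib_left by (rule sum.swap)
    also have "\<dots> = (\<Sum>l\<in>Yd N \<inter> ptn n. pmf (M N) l * ?e l / ?e l)"
      unfolding jack_eval_def by (intro sum.cong) (auto simp: ptn_def)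
    finally show ?thesis .
  qed
  have S_nonneg: "0 \<le> S n" for n unfolding S by (intro sum_nonneg) (simp add: divide_simps)
  have S0: "S n = 0" for n
    using S_sum \<open>\<not> ?F > 0\<close> S_nonneg by (intro nonneg_has_sum_le_0D[OF S_sum]) auto
  have z: "pmf (M N) l * ?e l / ?e l = 0" if l: "l \<in> Yd N \<inter> ptn n" for l n
  proof -
    have "(\<Sum>l\<in>Yd N \<inter> ptn n. pmf (M N) l * ?e l / ?e l) = 0"
      using S0[of n] unfolding S .
    then have "\<forall>l\<in>Yd N \<inter> ptn n. pmf (M N) l * ?e l / ?e l = 0"
      by (subst (asm) sum_nonneg_eq_0_iff) (auto simp: finite_ptn divide_simps)
    then show ?thesis using l by (rule bspec)
  qed
  show "\<forall>m\<in>partitions. acoef \<theta> M N m = 0"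
    \<comment> \<open>By \<open>z\<close>, either the probability or the divisor is 0; both make the
      summand 0.\<close>
    unfolding acoef_def by (intro ballI sum.neutral) (use z in fastforce)
qed

lemma poly_weight_summable:
  fixes b :: "nat list \<Rightarrow> real"
  assumes "(\<lambda>m. \<bar>b m\<bar> * R' ^ sum_list m) summable_on I" "0 < R" "R < R'"
  shows "(\<lambda>m. \<bar>b m\<bar> * R ^ sum_list m * real (Suc (sum_list m)) ^ n) summable_on I"
proof -
  let ?q = "R / R'"
  have q: "0 < ?q" "?q < 1" using assms by auto
  obtain C \<sigma> where C: "0 < \<sigma>" "\<sigma> < 1" "0 < C" "\<And>k. real k ^ n * ?q ^ k \<le> C * \<sigma> ^ k"
    using poly_geometric_bound[OF q, of n] by metis
  have bound: "R ^ k * real (Suc k) ^ n \<le> C / ?q * R' ^ k" for k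
  proof -
    \<comment> \<open>The weight has base \<open>Suc k\<close>, so the bound is taken there, and the
      surplus factor \<open>?q\<close> is divided out.\<close>
    have "real (Suc k) ^ n * ?q ^ Suc k \<le> C * \<sigma> ^ Suc k" by (rule C(4))
    also have "\<dots> \<le> C * 1" using C by (intro mult_left_mono power_le_one) auto
    finally have "(real (Suc k) ^ n * ?q ^ k) * ?q \<le> C"
      by (simp only: power_Suc mult_ac mult_1_right)
    then have "real (Suc k) ^ n * ?q ^ k \<le> C / ?q"
      by (simp only: pos_le_divide_eq[OF q(1)])
    then have "real (Suc k) ^ n * ?q ^ k * R' ^ k \<le> C / ?q * R' ^ k"
      using assms by (intro mult_right_mono) auto
    then show ?thesis using assms by (simp add: power_divide mult_ac)
  qed
  show ?thesis
  proof (rule summable_on_dominated[OF summable_on_cmult_right[OF assms(1), of "C / ?q"]])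
    fix m
    have "\<bar>b m\<bar> * (R ^ sum_list m * real (Suc (sum_list m)) ^ n) \<le> \<bar>b m\<bar> * (C / ?q * R' ^ sum_list m)"
      by (intro mult_left_mono bound) auto
    then show "\<bar>\<bar>b m\<bar> * R ^ sum_list m * real (Suc (sum_list m)) ^ n\<bar>
        \<le> C / ?q * (\<bar>b m\<bar> * R' ^ sum_list m)"
      using assms(2) by (simp add: abs_mult mult_ac)
  qed
qed

lemma pdiff_Psi:
  assumes A: "assumpA \<theta> M" and N: "1 \<le> N" and js: "js \<noteq> []"
  shows "pdiff js (Psi \<theta> M N) (\<lambda>_. 1) = powsum_subst {..<N} (Dsum \<theta> M N) js"
proof -
  let ?a = "acoef \<theta> M N"
  obtain \<epsilon> where \<epsilon>: "\<epsilon> > 0" "\<And>x. \<bar>x\<bar> < 1 + \<epsilon> \<Longrightarrow>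
      (\<lambda>m. \<bar>?a m\<bar> * real N ^ length m * \<bar>x\<bar> ^ sum_list m) summable_on partitions"
    using A unfolding assumpA_def by blast
  \<comment> \<open>Two radii in (1, 1 + \<epsilon>): summability holds at \<open>R'\<close>, and
    the gap down to \<open>R\<close> pays for the polynomial weights.\<close>
  define R where "R = 1 + \<epsilon> / 3"
  define R' where "R' = 1 + \<epsilon> / 2"
  have R: "1 < R" "R < R'" "\<bar>R'\<bar> < 1 + \<epsilon>" "0 < R'" using \<epsilon>(1) by (auto simp: R_def R'_def)
  have "(\<lambda>m. \<bar>?a m * real N ^ length m\<bar> * R' ^ sum_list m) summable_on partitions"
    using \<epsilon>(2)[OF R(3)] R(4) by (simp add: abs_mult)
  from poly_weight_summable[OF this _ R(2)] R(1)
  have a: "(\<lambda>m. \<bar>?a m\<bar> * real N ^ length m * R ^ sum_list m * real (Suc (sum_list m)) ^ n)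
      summable_on partitions" for n
    by (simp add: abs_mult)
  have "(\<lambda>m. \<bar>?a m\<bar> * real N ^ length m) summable_on partitions"
    using \<epsilon>(2)[of 1] \<epsilon>(1) by simp
  from FN_pos_or_zero[OF this] show ?thesis
  proof
    assume "FN \<theta> M N (\<lambda>_. real N) > 0"
    from pdiff_expansion[OF N R(1) a, of "FN \<theta> M N", OF _ this js]
    show ?thesis
      unfolding powsum_subst_def Dsum_def lnF_def[abs_def] Psi_def[abs_def] FNx_def FN_def[abs_def] by simp
  next
    \<comment> \<open>Degenerate case: ln F_N is constant, and for nonempty \<open>js\<close> no
      term has an empty \<open>ks\<close>, so both sides are 0.\<close>
    assume "\<forall>m\<in>partitions. ?a m = 0"
    then have F: "FN \<theta> M N p = 0" for p unfolding FN_def by (intro infsum_0) simp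
    have D: "Dsum \<theta> M N ks = 0" if "ks \<noteq> []" for ks
    proof -
      have "pdiff is (\<lambda>_. ln 0) (\<lambda>_. real N) = 0" if "is \<in> tuples (length ks)" for "is"
        using that \<open>ks \<noteq> []\<close> pdiff_const[of "is" "ln 0"] by (cases "is = []") (auto simp: tuples_def)
      then show ?thesis unfolding Dsum_def lnF_def[abs_def] F by (intro infsum_0) simp
    qed
    have "w * Dsum \<theta> M N ks = 0" if "(w, ks) \<in> set (terms {..<N} js)" for w ks
      using D[OF terms_nonempty[OF that js]] by simp
    then have "powsum_subst {..<N} (Dsum \<theta> M N) js = (\<Sum>(w, ks)\<leftarrow>terms {..<N} js. 0)"
      unfolding powsum_subst_def by (intro arg_cong[of _ _ sum_list] map_cong refl) auto
    then have "powsum_subst {..<N} (Dsum \<theta> M N) js = 0" by (simp add: case_prod_unfold)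
    moreover have "pdiff js (Psi \<theta> M N) (\<lambda>_. 1) = 0"
      using pdiff_const[OF js] by (simp add: Psi_def[abs_def] FNx_def F)
    ultimately show ?thesis by simp
  qed
qed

subsection \<open>Asymptotics\<close>

text \<open>The blocks partition the positions, and each carries a single index, so every distinct
  index needs a block of its own.\<close>

lemma terms_props:
  "(w, ks) \<in> set (terms A js) \<Longrightarrow> sum_list ks = length js \<and> card (set js) \<le> length ks"
proof (induction "length js" arbitrary: js w ks rule: less_induct)
  case less
  show ?case
  proof (cases js)
    case (Cons i l)
    then obtain k t w' ks' where *: "(k, t) \<in> set (ext i l)" "(w', ks') \<in> set (terms A t)"
      "ks = Suc k # ks'" using less.prems by (auto split: if_splits)
    have len: "k + length t = length l" using ext_length[OF *(1)] .
    then have IH: "sum_list ks' = length t" "card (set t) \<le> length ks'"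
      using less.hyps[OF _ *(2)] Cons by auto
    have "set js \<subseteq> insert i (set t)" using ext_set[OF *(1)] Cons by auto
    then have "card (set js) \<le> card (insert i (set t))" by (intro card_mono) auto
    also have "\<dots> \<le> Suc (card (set t))" by (rule card_insert_le_m1) auto
    finally show ?thesis using IH len * Cons by simp
  qed (use less in auto)
qed

text \<open>Makes the expansion independent of N once N exceeds all indices, so that limits can be
  taken term by term.\<close>

lemma terms_restrict: "set js \<subseteq> A \<Longrightarrow> terms A js = terms UNIV js"
proof (induction "length js" arbitrary: js rule: less_induct)
  case less
  show ?case
  proof (cases js)
    case (Cons i l)
    have "terms A t = terms UNIV t" if "(k, t) \<in> set (ext i l)" for k t
      using less.hyps[of t] less.prems ext_length[OF that] ext_set[OF that] Cons by auto
    then have "map (\<lambda>(k, t). map (\<lambda>(w, ks). (fact (Suc k) * w, Suc k # ks)) (terms A t)) (ext i l)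
        = map (\<lambda>(k, t). map (\<lambda>(w, ks). (fact (Suc k) * w, Suc k # ks)) (terms UNIV t)) (ext i l)"
      by (intro map_cong refl) auto
    then show ?thesis using less.prems Cons by (simp del: map_eq_conv fact_Suc)
  qed simp
qed

section \<open>The shortest term of the expansion\<close>

definition blocks :: "(nat \<times> nat) list \<Rightarrow> nat list" where
  "blocks cs = concat (map (\<lambda>(c, k). replicate k c) cs)"

lemma blocks_simps [simp]:
  "blocks [] = []" "blocks ((c, k) # cs) = replicate k c @ blocks cs"
  by (simp_all add: blocks_def)

lemma set_blocks: "\<forall>k\<in>set (map snd cs). 1 \<le> k \<Longrightarrow> set (blocks cs) = set (map fst cs)"
  by (induction cs) (auto simp: rev_image_eqI split: if_splits)

lemma length_blocks: "length (blocks cs) = sum_list (map snd cs)"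
  by (induction cs) auto

lemma ext_notin: "i \<notin> set l \<Longrightarrow> ext i l = [(0, l)]"
  by (induction l) auto

text \<open>A remainder free of \<open>i\<close> arises only by putting every further copy of
  \<open>i\<close> into the block, which is a single choice.\<close>

lemma filter_ext:
  "i \<notin> set l \<Longrightarrow> filter (\<lambda>(k, t). i \<notin> set t) (ext i (replicate a i @ l)) = [(a, l)]"
proof (induction a)
  case (Suc a)
  then show ?case by (auto simp: filter_map o_def case_prod_unfold)
qed (simp add: ext_notin)

lemma concat_map_if:
  "concat (map (\<lambda>x. if P x then f x else []) xs) = concat (map f (filter P xs))"
  by (induction xs) auto

text \<open>The number of distinct indices is the least possible number of blocks, attained only
  when all copies of each index form one block.\<close>

lemma filter_terms_blocks:
  assumes "distinct (map fst cs)" "\<forall>k\<in>set (map snd cs). 1 \<le> k"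
  shows "filter (\<lambda>(w, ks). length ks \<le> length cs) (terms UNIV (blocks cs))
     = [(prod_list (map fact (map snd cs)), map snd cs)]"
  using assms
proof (induction cs)
  case (Cons x cs)
  obtain i a where x: "x = (i, Suc a)" using Cons.prems by (cases x; cases "snd x") auto
  let ?n = "length cs" and ?l = "blocks cs"
  let ?g = "\<lambda>k. map (\<lambda>(w, ks). (fact (Suc k) * w, Suc k # ks :: nat list)) :: (real \<times> nat list) list \<Rightarrow> _"
  have sl: "set ?l = set (map fst cs)" using Cons.prems by (intro set_blocks) auto
  then have i: "i \<notin> set ?l" using Cons.prems x by auto
  have "filter (\<lambda>(w, ks). length ks \<le> Suc ?n) (?g k (terms UNIV t))
      = (if i \<notin> set t then ?g k (filter (\<lambda>(w, ks). length ks \<le> ?n) (terms UNIV t)) else [])"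
    if "(k, t) \<in> set (ext i (replicate a i @ ?l))" for k t
  proof (cases "i \<in> set t")
    \<comment> \<open>If a copy of \<open>i\<close> is left over, then \<open>length cs + 1\<close>
      indices still await blocks; with the block just formed there are too many, and the filter
      drops them.\<close>
    case True
    have "insert i (set ?l) \<subseteq> set t" using ext_set[OF that] True by auto
    then have "card (insert i (set ?l)) \<le> card (set t)" by (intro card_mono) auto
    moreover have "card (set ?l) = ?n"
      unfolding sl using Cons.prems by (subst distinct_card) auto
    ultimately have "Suc ?n \<le> card (set t)" using i by simp
    then have "Suc ?n \<le> length ks" if "(w, ks) \<in> set (terms UNIV t)" for w ks
      using terms_props[OF that] by linarith
    then show ?thesis using True by (fastforce simp: filter_map o_def case_prod_unfold filter_empty_conv)
  qed (simp add: filter_map o_def case_prod_unfold)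
  then have "filter (\<lambda>(w, ks). length ks \<le> Suc ?n) (terms UNIV (blocks (x # cs)))
    = concat (map (\<lambda>z. if case z of (k, t) \<Rightarrow> i \<notin> set t
         then (case z of (k, t) \<Rightarrow> ?g k (filter (\<lambda>(w, ks). length ks \<le> ?n) (terms UNIV t))) else [])
        (ext i (replicate a i @ ?l)))"
    by (auto simp: x filter_concat o_def simp del: fact_Suc intro!: arg_cong[of _ _ concat] map_cong)
  also have "\<dots> = ?g a (filter (\<lambda>(w, ks). length ks \<le> ?n) (terms UNIV ?l))"
    unfolding concat_map_if filter_ext[OF i] by (simp del: fact_Suc)
  also have "\<dots> = [(prod_list (map fact (map snd (x # cs))), map snd (x # cs))]"
    using Cons x by (simp del: fact_Suc)
  finally show ?case by simp
qed simp

lemma sum_list_filter_split: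
  fixes f :: "'a \<Rightarrow> real"
  shows "(\<Sum>x\<leftarrow>xs. f x) = (\<Sum>x\<leftarrow>filter P xs. f x) + (\<Sum>x\<leftarrow>filter (\<lambda>x. \<not> P x) xs. f x)"
  by (induction xs) auto

text \<open>The triangular form of the system. \<open>rest\<close> is fixed before \<open>b\<close>,
  so with \<open>b = D N\<close> its coefficients do not depend on N.\<close>

lemma powsum_subst_blocks:
  assumes "distinct (map fst cs)" "\<forall>k\<in>set (map snd cs). 1 \<le> k"
  obtains rest where
    "\<And>b. powsum_subst UNIV b (blocks cs)
       = prod_list (map fact (map snd cs)) * b (map snd cs) + (\<Sum>(w, ks)\<leftarrow>rest. w * b ks)"
    "\<And>w ks. (w, ks) \<in> set rest \<Longrightarrow>
       length cs < length ks \<and> sum_list ks = sum_list (map snd cs) \<and> (\<forall>k\<in>set ks. 1 \<le> k)"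
proof
  let ?P = "\<lambda>(w, ks). length ks \<le> length cs"
  let ?rest = "filter (\<lambda>x. \<not> ?P x) (terms UNIV (blocks cs))"
  show "powsum_subst UNIV b (blocks cs)
       = prod_list (map fact (map snd cs)) * b (map snd cs) + (\<Sum>(w, ks)\<leftarrow>?rest. w * b ks)" for b
    unfolding powsum_subst_def
    by (subst sum_list_filter_split[where P = ?P], subst filter_terms_blocks[OF assms]) simp
  show "length cs < length ks \<and> sum_list ks = sum_list (map snd cs) \<and> (\<forall>k\<in>set ks. 1 \<le> k)"
    if "(w, ks) \<in> set ?rest" for w ks
    using that terms_props[of w ks UNIV "blocks cs"] terms_pos[of w ks UNIV "blocks cs"]
    by (auto simp: length_blocks)
qed

section \<open>Transfer of limits in both directions\<close>

lemma tendsto_sum_list_zero: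
  fixes D :: "nat \<Rightarrow> nat list \<Rightarrow> real"
  assumes "\<And>w ks. (w, ks) \<in> set xs \<Longrightarrow> (\<lambda>N. \<sigma> N * D N ks) \<longlonglongrightarrow> 0"
  shows "(\<lambda>N. \<sigma> N * (\<Sum>(w, ks)\<leftarrow>xs. w * D N ks)) \<longlonglongrightarrow> 0"
  using assms
proof (induction xs)
  case (Cons x xs)
  obtain w ks where x: "x = (w, ks)" by force
  have "(\<lambda>N. w * (\<sigma> N * D N ks) + \<sigma> N * (\<Sum>(w, ks)\<leftarrow>xs. w * D N ks)) \<longlonglongrightarrow> w * 0 + 0"
    using Cons x by (intro tendsto_intros) auto
  then show ?case by (simp add: x algebra_simps)
qed simp

context
  fixes D P :: "nat \<Rightarrow> nat list \<Rightarrow> real"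
  assumes P: "\<And>N js. 1 \<le> N \<Longrightarrow> js \<noteq> [] \<Longrightarrow> P N js = powsum_subst {..<N} (D N) js"
begin

lemma eventually_P:
  assumes "js \<noteq> []"
  shows "\<forall>\<^sub>F N in sequentially. P N js = powsum_subst UNIV (D N) js"
  using eventually_gt_at_top[of "Max (set js)"]
proof eventually_elim
  case (elim N)
  have "set js \<subseteq> {..<N}"
    using elim assms Max_ge[of "set js"] le_less_trans by blast
  then show ?case
    using P[of N js] assms elim terms_restrict[of js "{..<N}"] by (simp add: powsum_subst_def)
qed

text \<open>The factor \<open>\<sigma>\<close> is a normalisation, later 1/N or 1. Every
  \<open>ks\<close> in the expansion has at least as many entries as \<open>js\<close> has distinct
  indices.\<close>

lemma P_zero:
  assumes D: "\<And>ks. r \<le> length ks \<Longrightarrow> \<forall>k\<in>set ks. 1 \<le> k \<Longrightarrow> (\<lambda>N. \<sigma> N * D N ks) \<longlonglongrightarrow> 0"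
    and js: "js \<noteq> []" "r \<le> card (set js)"
  shows "(\<lambda>N. \<sigma> N * P N js) \<longlonglongrightarrow> 0"
proof -
  have "(\<lambda>N. \<sigma> N * powsum_subst UNIV (D N) js) \<longlonglongrightarrow> 0"
    unfolding powsum_subst_def
    by (intro tendsto_sum_list_zero D) (use js terms_props terms_pos in \<open>blast intro: order_trans\<close>)+
  then show ?thesis
    by (rule Lim_transform_eventually)
       (use eventually_P[OF js(1)] in \<open>auto elim: eventually_mono\<close>)
qed

lemma P_blocks_diff:
  assumes D: "\<And>ks. length cs < length ks \<Longrightarrow> sum_list ks = sum_list (map snd cs) \<Longrightarrow>
      \<forall>k\<in>set ks. 1 \<le> k \<Longrightarrow> (\<lambda>N. \<sigma> N * D N ks) \<longlonglongrightarrow> 0"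
    and cs: "distinct (map fst cs)" "\<forall>k\<in>set (map snd cs). 1 \<le> k" "cs \<noteq> []"
  shows "(\<lambda>N. \<sigma> N * P N (blocks cs) - prod_list (map fact (map snd cs)) * (\<sigma> N * D N (map snd cs)))
     \<longlonglongrightarrow> 0"
proof -
  obtain rest where rest: "\<And>b. powsum_subst UNIV b (blocks cs)
       = prod_list (map fact (map snd cs)) * b (map snd cs) + (\<Sum>(w, ks)\<leftarrow>rest. w * b ks)"
    "\<And>w ks. (w, ks) \<in> set rest \<Longrightarrow>
       length cs < length ks \<and> sum_list ks = sum_list (map snd cs) \<and> (\<forall>k\<in>set ks. 1 \<le> k)"
    using powsum_subst_blocks[OF cs(1,2)] by metis
  have "(\<lambda>N. \<sigma> N * (\<Sum>(w, ks)\<leftarrow>rest. w * D N ks)) \<longlonglongrightarrow> 0"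
    by (intro tendsto_sum_list_zero D) (use rest(2) in blast)+
  then show ?thesis
  proof (rule Lim_transform_eventually)
    have "blocks cs \<noteq> []" using cs set_blocks[OF cs(2)] by (cases cs) auto
    from eventually_P[OF this]
    show "\<forall>\<^sub>F N in sequentially. \<sigma> N * (\<Sum>(w, ks)\<leftarrow>rest. w * D N ks)
        = \<sigma> N * P N (blocks cs) - prod_list (map fact (map snd cs)) * (\<sigma> N * D N (map snd cs))"
      by eventually_elim (simp add: rest(1) algebra_simps)
  qed
qed

lemma prod_list_fact_nonzero: "prod_list (map fact ks) \<noteq> (0::real)"
  by (induction ks) auto

text \<open>Among the lists \<open>ks\<close> with a given sum, induction from long to short ones: colouring the
  entries of \<open>ks\<close> with distinct indices makes \<open>ks\<close> the unique shortest term.\<close>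
lemma D_zero:
  assumes Pz: "\<And>js. js \<noteq> [] \<Longrightarrow> r \<le> card (set js) \<Longrightarrow> (\<lambda>N. \<sigma> N * P N js) \<longlonglongrightarrow> 0"
    and ks: "1 \<le> r" "r \<le> length ks" "\<forall>k\<in>set ks. 1 \<le> k"
  shows "(\<lambda>N. \<sigma> N * D N ks) \<longlonglongrightarrow> 0"
  using ks(2,3)
proof (induction "sum_list ks - length ks" arbitrary: ks rule: less_induct)
  case (less ks)
  \<comment> \<open>Ensures that the natural subtraction in the induction measure drops strictly
    when a list gets longer with the same sum.\<close>
  have len: "length l \<le> sum_list l" if "\<forall>k\<in>set l. 1 \<le> k" for l :: "nat list"
    using that by (induction l) auto
  define cs where "cs = zip [0..<length ks] ks"
  have cs: "map fst cs = [0..<length ks]" "map snd cs = ks" "length cs = length ks"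
    by (simp_all add: cs_def)
  have ne: "cs \<noteq> []" using less.prems ks(1) cs by auto
  have sb: "set (blocks cs) = {0..<length ks}"
    using set_blocks[of cs] less.prems cs by simp
  have "(\<lambda>N. \<sigma> N * P N (blocks cs)) \<longlonglongrightarrow> 0"
  proof (rule Pz)
    show "blocks cs \<noteq> []" using sb less.prems ks(1) by auto
    show "r \<le> card (set (blocks cs))" using sb less.prems by simp
  qed
  moreover have "(\<lambda>N. \<sigma> N * P N (blocks cs) - prod_list (map fact (map snd cs)) * (\<sigma> N * D N (map snd cs)))
     \<longlonglongrightarrow> 0"
  proof (rule P_blocks_diff)
    fix ks' assume *: "length cs < length ks'" "sum_list ks' = sum_list (map snd cs)" "\<forall>k\<in>set ks'. 1 \<le> k"
    show "(\<lambda>N. \<sigma> N * D N ks') \<longlonglongrightarrow> 0"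
      by (rule less.hyps) (use * cs less.prems len[OF *(3)] in auto)
  qed (use cs less.prems ne in auto)
  ultimately have "(\<lambda>N. prod_list (map fact ks) * (\<sigma> N * D N ks)) \<longlonglongrightarrow> 0"
    unfolding cs using tendsto_diff by fastforce
  from tendsto_mult_left[OF this, of "1 / prod_list (map fact ks)"]
  show ?case using prod_list_fact_nonzero[of ks] by simp
qed

lemma P_blocks_limit:
  assumes "\<And>ks. length cs < length ks \<Longrightarrow> \<forall>k\<in>set ks. 1 \<le> k \<Longrightarrow> (\<lambda>N. \<sigma> N * D N ks) \<longlonglongrightarrow> 0"
    and "distinct (map fst cs)" "\<forall>k\<in>set (map snd cs). 1 \<le> k" "cs \<noteq> []"
  shows "(\<lambda>N. \<sigma> N * P N (blocks cs)) \<longlonglongrightarrow> L \<longleftrightarrow>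
     (\<lambda>N. prod_list (map fact (map snd cs)) * (\<sigma> N * D N (map snd cs))) \<longlonglongrightarrow> L"
  using P_blocks_diff[of cs \<sigma>] assms by (intro Lim_transform_eq) auto

lemma zero_iff:
  assumes "1 \<le> r"
  shows "(\<forall>ks. r \<le> length ks \<and> (\<forall>k\<in>set ks. 1 \<le> k) \<longrightarrow> (\<lambda>N. \<sigma> N * D N ks) \<longlonglongrightarrow> 0) \<longleftrightarrow>
    (\<forall>js. r \<le> length js \<and> r \<le> card (set js) \<longrightarrow> (\<lambda>N. \<sigma> N * P N js) \<longlonglongrightarrow> 0)"
    (is "?D \<longleftrightarrow> ?P")
proof
  assume D: ?D
  show ?P
  proof (intro allI impI)
    fix js :: "nat list" assume "r \<le> length js \<and> r \<le> card (set js)"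
    then show "(\<lambda>N. \<sigma> N * P N js) \<longlonglongrightarrow> 0"
      using P_zero[of r \<sigma> js] D assms by force
  qed
next
  assume P: ?P
  have "(\<lambda>N. \<sigma> N * P N js) \<longlonglongrightarrow> 0" if "r \<le> card (set js)" for js
    using P that card_length[of js] order_trans by blast
  then show ?D using D_zero[of r \<sigma>] assms by blast
qed

lemma single_iff:
  assumes "\<And>ks. 2 \<le> length ks \<Longrightarrow> \<forall>k\<in>set ks. 1 \<le> k \<Longrightarrow> (\<lambda>N. \<sigma> N * D N ks) \<longlonglongrightarrow> 0" "1 \<le> k"
  shows "(\<lambda>N. \<sigma> N * P N (replicate k i)) \<longlonglongrightarrow> L \<longleftrightarrow> (\<lambda>N. \<sigma> N * (fact k * D N [k])) \<longlonglongrightarrow> L"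
  using P_blocks_limit[of "[(i, k)]" \<sigma> L] assms by (simp add: mult.left_commute)

lemma pair_iff:
  assumes "\<And>ks. 3 \<le> length ks \<Longrightarrow> \<forall>k\<in>set ks. 1 \<le> k \<Longrightarrow> (\<lambda>N. D N ks) \<longlonglongrightarrow> 0"
    and "1 \<le> k" "1 \<le> l" "i \<noteq> j"
  shows "(\<lambda>N. P N (replicate k i @ replicate l j)) \<longlonglongrightarrow> L \<longleftrightarrow>
     (\<lambda>N. fact k * fact l * D N [k, l]) \<longlonglongrightarrow> L"
  using P_blocks_limit[of "[(i, k), (j, l)]" "\<lambda>_. 1" L] assms by (simp add: numeral_eq_Suc)

end

lemma pair_length_cases:
  assumes "2 \<le> length ks"
  obtains "3 \<le> length ks" | k l where "ks = [k, l]"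
  using assms by (cases ks; cases "tl ks"; cases "tl (tl ks)") auto

theorem theoremB1:
  fixes \<theta> :: real and M :: "nat \<Rightarrow> nat list pmf"
    and c :: "nat \<Rightarrow> real" and d :: "nat \<Rightarrow> nat \<Rightarrow> real"
  assumes "\<theta> > 0"
    and "\<forall>N. set_pmf (M N) \<subseteq> Yd N"
    and "assumpA \<theta> M"
  shows "(assumpL \<theta> M c \<longleftrightarrow> xcondL \<theta> M c) \<and>
         (assumpC \<theta> M c d \<longleftrightarrow> xcondC \<theta> M c d)"
proof -
  define D where "D = Dsum \<theta> M"
  define P where "P N js = pdiff js (Psi \<theta> M N) (\<lambda>_. 1)" for N js
  define s where "s N = 1 / real N" for N :: nat
  have P: "P N js = powsum_subst {..<N} (D N) js" if "1 \<le> N" "js \<noteq> []" for N js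
    unfolding P_def D_def using pdiff_Psi[OF assms(3) that] .
  note folds = D_def[symmetric] P_def[symmetric]
  define D1 where "D1 \<longleftrightarrow> (\<forall>k\<ge>1. (\<lambda>N. s N * (fact k * D N [k])) \<longlonglongrightarrow> c k)"
  define P1 where "P1 \<longleftrightarrow> (\<forall>i. \<forall>k\<ge>1. (\<lambda>N. s N * P N (replicate k i)) \<longlonglongrightarrow> c k)"
  define D0 where "D0 \<sigma> r \<longleftrightarrow> (\<forall>ks. r \<le> length ks \<and> (\<forall>k\<in>set ks. 1 \<le> k) \<longrightarrow>
      (\<lambda>N. \<sigma> N * D N ks) \<longlonglongrightarrow> 0)" for \<sigma> :: "nat \<Rightarrow> real" and r
  define P0 where "P0 \<sigma> r \<longleftrightarrow> (\<forall>js. r \<le> length js \<and> r \<le> card (set js) \<longrightarrow>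
      (\<lambda>N. \<sigma> N * P N js) \<longlonglongrightarrow> 0)" for \<sigma> :: "nat \<Rightarrow> real" and r
  define D2 where "D2 \<longleftrightarrow> (\<forall>k\<ge>1. \<forall>l\<ge>1. (\<lambda>N. fact k * fact l * D N [k, l]) \<longlonglongrightarrow> d k l)"
  define P2 where "P2 \<longleftrightarrow> (\<forall>i j. \<forall>k\<ge>1. \<forall>l\<ge>1. i \<noteq> j \<longrightarrow>
      (\<lambda>N. P N (replicate k i @ replicate l j)) \<longlonglongrightarrow> d k l)"
  have zero: "D0 \<sigma> r \<longleftrightarrow> P0 \<sigma> r" if "1 \<le> r" for \<sigma> r
    unfolding D0_def P0_def using zero_iff[of P D, OF P that] by blast
  have one: "D1 \<longleftrightarrow> P1" if "D0 s 2"
    using single_iff[of P D, OF P, of s] that unfolding D0_def D1_def P1_def by blast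
  have two: "D2 \<longleftrightarrow> P2" if "D0 (\<lambda>_. 1) 3"
  proof -
    have "(\<lambda>N. P N (replicate k i @ replicate l j)) \<longlonglongrightarrow> d k l \<longleftrightarrow>
        (\<lambda>N. fact k * fact l * D N [k, l]) \<longlonglongrightarrow> d k l" if "1 \<le> k" "1 \<le> l" "i \<noteq> j" for k l i j
      using pair_iff[of P D, OF P _ that] \<open>D0 (\<lambda>_. 1) 3\<close> unfolding D0_def by simp
    \<comment> \<open>Recovering \<open>D2\<close> from \<open>P2\<close> requires some pair of
      distinct indices.\<close>
    moreover have "(0::nat) \<noteq> 1" by simp
    ultimately show ?thesis unfolding D2_def P2_def by meson
  qed
  have s0: "s \<longlonglongrightarrow> 0" unfolding s_def[abs_def] by (rule lim_1_over_n)
  \<comment> \<open>In (b) the pure derivatives are still divided by N, so terms with two or more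
    blocks must vanish after this division. They do, since undivided they converge.\<close>
  have low: "D0 s 2" if D2 and "D0 (\<lambda>_. 1) 3"
    unfolding D0_def
  proof (intro allI impI)
    fix ks :: "nat list" assume ks: "2 \<le> length ks \<and> (\<forall>k\<in>set ks. 1 \<le> k)"
    have "\<exists>L. (\<lambda>N. D N ks) \<longlonglongrightarrow> L"
      using ks
    proof (elim conjE pair_length_cases)
      assume "3 \<le> length ks"
      then show ?thesis using that(2) ks unfolding D0_def by auto
    next
      fix k l assume "ks = [k, l]"
      then have "(\<lambda>N. fact k * fact l * D N ks) \<longlonglongrightarrow> d k l"
        using that(1) ks unfolding D2_def by simp
      from tendsto_mult_left[OF this, of "1 / (fact k * fact l)"]
      show ?thesis by auto
    qed
    then show "(\<lambda>N. s N * D N ks) \<longlonglongrightarrow> 0" using tendsto_mult[OF s0] by fastforce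
  qed
  have "assumpL \<theta> M c \<longleftrightarrow> D1 \<and> D0 s 2"
    unfolding assumpL_def D1_def D0_def folds s_def by simp
  moreover have "xcondL \<theta> M c \<longleftrightarrow> P1 \<and> P0 s 2"
    unfolding xcondL_def P1_def P0_def folds s_def by simp
  moreover have "assumpC \<theta> M c d \<longleftrightarrow> D1 \<and> D2 \<and> D0 (\<lambda>_. 1) 3"
    unfolding assumpC_def D1_def D2_def D0_def folds s_def by simp
  moreover have "xcondC \<theta> M c d \<longleftrightarrow> P1 \<and> P2 \<and> P0 (\<lambda>_. 1) 3"
    unfolding xcondC_def P1_def P2_def P0_def folds s_def by simp
  \<comment> \<open>\<open>one\<close> and \<open>two\<close> presuppose vanishing limits for longer
    lists, so the conditions are exchanged from the highest order downwards.\<close>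
  ultimately show ?thesis
    using one two low zero[of 2 s] zero[of 3 "\<lambda>_. 1"] by auto
qed

end
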